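(* For each $\alpha$ in $(0,\infty)$ the density $f_\alpha$ of the free Gamma distribution $\nu_\alpha$ is unimodal. In fact, there exists a number $\omega_\alpha$ in $(s_\alpha,\infty)$ such that $f_\alpha$ is strictly increasing on $[s_\alpha,\omega_\alpha]$ and strictly decreasing on $[\omega_\alpha,\infty)$.
   Context: For $\alpha>0$ the free Gamma distribution $\nu_\alpha=\Lambda(\mu_\alpha)$ is the image under the Bercovici–Pata bijection $\Lambda$ of the classical Gamma distribution $\mu_\alpha(dt)=\frac1{\Gamma(\alpha)}t^{\alpha-1}e^{-t}1_{[0,\infty)}(t)\,dt$. ($\Lambda$ sends the $*$-infinitely divisible law with Lévy–Khintchine triplet $(a,\rho,\eta)$ to the law, infinitely divisible for free additive convolution, whose free cumulant transform $\mathcal{C}(z)=zG^{\langle-1\rangle}(z)-1$, with $G$ the Cauchy transform, equals $\eta z+az^2+\int_{\mathbb{R}}(\frac1{1-tz}-1-tz1_{[-1,1]}(t))\,\rho(dt)$.) The measure $\nu_\alpha$ is absolutely continuous, and its density $f_\alpha$ is the following function. For $z\in\mathbb{C}\setminus[0,\infty)$ put $H_\alpha(z)=z+\alpha+\alpha\int_0^\infty\frac{te^{-t}}{z-t}\,dt$ and $F(z)=\int_0^\infty\frac{te^{-t}}{|z-t|^2}\,dt$. $c_\alpha$ is the unique positive number with $F(-c_\alpha)=\frac1\alpha$. $v_\alpha\colon\mathbb{R}\to[0,\infty)$ is given by $v_\alpha(x)=0$ for $x\le-c_\alpha$, and for $x>-c_\alpha$, $v_\alpha(x)$ is the unique $y>0$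 with $F(x+\mathrm{i}y)=\frac1\alpha$. Then $H_\alpha(x+\mathrm{i}v_\alpha(x))\in\mathbb{R}$ for all $x\in\mathbb{R}$, and $P_\alpha(x)=H_\alpha(x+\mathrm{i}v_\alpha(x))$ defines a strictly increasing bijection $P_\alpha\colon\mathbb{R}\to\mathbb{R}$ with inverse $P_\alpha^{\langle-1\rangle}$. Put $s_\alpha=P_\alpha(-c_\alpha)$ and $Q_\alpha(x)=\frac{v_\alpha(x)}{x^2+v_\alpha(x)^2}$. Then $f_\alpha(\xi)=0$ for $\xi\le s_\alpha$ and $f_\alpha(\xi)=\frac1\pi Q_\alpha(P_\alpha^{\langle-1\rangle}(\xi))$ for $\xi>s_\alpha$. *)

theory Defs
  imports "HOL-Probability.Probability"
begin

definition gamma_distribution :: "real \<Rightarrow> real measure" where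
  "gamma_distribution \<alpha> =
     density lborel (\<lambda>t. ennreal (indicator {0..} t * (t powr (\<alpha> - 1) * exp (- t) / Gamma \<alpha>)))"


text \<open>The classical triplet, with Gaussian part \<open>a\<close>, Levy measure \<open>\<rho>\<close> and drift \<open>\<eta>\<close> (for the
  truncation function \<open>t 1\<^bsub>[-1,1]\<^esub>(t)\<close>).  Possessing a triplet is the same as being
  infinitely divisible, and the triplet is then unique.\<close>

definition levy_measure :: "real measure \<Rightarrow> bool" where
  "levy_measure \<rho> \<longleftrightarrow> sets \<rho> = sets borel \<and> emeasure \<rho> {0} = 0 \<and>
     (\<integral>\<^sup>+t. ennreal (min 1 (t\<^sup>2)) \<partial>\<rho>) < \<infinity>"

definition levy_khintchine_triplet ::
    "real measure \<Rightarrow> real \<Rightarrow> real measure \<Rightarrow> real \<Rightarrow> bool" where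
  "levy_khintchine_triplet \<mu> a \<rho> \<eta> \<longleftrightarrow>
     real_distribution \<mu> \<and> a \<ge> 0 \<and> levy_measure \<rho> \<and>
     (\<forall>u. char \<mu> u =
        exp (\<i> * of_real (\<eta> * u) - of_real (a * u\<^sup>2 / 2) +
             (LINT t|\<rho>. iexp (u * t) - 1 - \<i> * of_real (u * t * indicator {-1..1} t))))"


definition cauchy_transform :: "real measure \<Rightarrow> complex \<Rightarrow> complex" where
  "cauchy_transform \<nu> z = (LINT t|\<nu>. 1 / (z - of_real t))"

definition truncated_cone :: "real \<Rightarrow> real \<Rightarrow> complex set" where
  "truncated_cone \<theta> M = {z. Im z > M \<and> \<bar>Re z\<bar> < \<theta> * Im z}"

text \<open>The Cauchy transform of a probability measure is injective on truncated cones in the upper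
  half-plane that lie far enough from the real axis; the free cumulant transform
  \<open>z G\<^sup>-\<^sup>1(z) - 1\<close> is formed with the inverse of \<open>G\<close> on such a cone \<open>D\<close>, and is
  meaningful for \<open>z\<close> in the image of \<open>D\<close> under \<open>G\<close>.  It is analytic, so its values for one cone
  determine it (and, in turn, the measure).\<close>

definition free_cumulant_transform :: "complex set \<Rightarrow> real measure \<Rightarrow> complex \<Rightarrow> complex" where
  "free_cumulant_transform D \<nu> z = z * the_inv_into D (cauchy_transform \<nu>) z - 1"

definition has_free_cumulant_transform :: "real measure \<Rightarrow> (complex \<Rightarrow> complex) \<Rightarrow> bool" where
  "has_free_cumulant_transform \<nu> C \<longleftrightarrow>
     (\<exists>\<theta>>0. \<exists>M>0. inj_on (cauchy_transform \<nu>) (truncated_cone \<theta> M) \<and>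
        (\<forall>z \<in> cauchy_transform \<nu> ` truncated_cone \<theta> M.
           free_cumulant_transform (truncated_cone \<theta> M) \<nu> z = C z))"

definition free_levy_khintchine :: "real \<Rightarrow> real measure \<Rightarrow> real \<Rightarrow> complex \<Rightarrow> complex" where
  "free_levy_khintchine a \<rho> \<eta> z =
     of_real \<eta> * z + of_real a * z\<^sup>2 +
     (LINT t|\<rho>. 1 / (1 - of_real t * z) - 1 - of_real (t * indicator {-1..1} t) * z)"

text \<open>\<open>bercovici_pata \<mu> \<nu>\<close> says that \<open>\<nu> = \<Lambda>(\<mu>)\<close>.  As the triplet of \<open>\<mu>\<close> is unique, the
  universal quantifier just names it.  Infinite divisibility of \<open>\<nu>\<close> for free additive convolution
  is not listed: a probability measure with this free cumulant transform is automatically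
  freely infinitely divisible, and it is the only such measure.\<close>

definition bercovici_pata :: "real measure \<Rightarrow> real measure \<Rightarrow> bool" where
  "bercovici_pata \<mu> \<nu> \<longleftrightarrow>
     (\<exists>a \<rho> \<eta>. levy_khintchine_triplet \<mu> a \<rho> \<eta>) \<and>
     (\<forall>a \<rho> \<eta>. levy_khintchine_triplet \<mu> a \<rho> \<eta> \<longrightarrow>
        real_distribution \<nu> \<and> has_free_cumulant_transform \<nu> (free_levy_khintchine a \<rho> \<eta>))"

definition free_gamma_distribution :: "real \<Rightarrow> real measure \<Rightarrow> bool" where
  "free_gamma_distribution \<alpha> \<nu> \<longleftrightarrow> bercovici_pata (gamma_distribution \<alpha>) \<nu>"


definition fg_H :: "real \<Rightarrow> complex \<Rightarrow> complex" where
  "fg_H \<alpha> z = z + of_real \<alpha> +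
     of_real \<alpha> * (LINT t:{0..}|lborel. of_real (t * exp (- t)) / (z - of_real t))"

definition fg_F :: "complex \<Rightarrow> real" where
  "fg_F z = (LINT t:{0..}|lborel. t * exp (- t) / (cmod (z - of_real t))\<^sup>2)"

definition fg_c :: "real \<Rightarrow> real" where
  "fg_c \<alpha> = (THE c. c > 0 \<and> fg_F (of_real (- c)) = 1 / \<alpha>)"

definition fg_v :: "real \<Rightarrow> real \<Rightarrow> real" where
  "fg_v \<alpha> x =
     (if x \<le> - fg_c \<alpha> then 0 else (THE y. y > 0 \<and> fg_F (Complex x y) = 1 / \<alpha>))"

text \<open>\<open>H\<^sub>\<alpha>\<close> is real-valued on the graph of \<open>v\<^sub>\<alpha>\<close>, so \<open>Re\<close> only serves as a coercion.\<close>

definition fg_P :: "real \<Rightarrow> real \<Rightarrow> real" where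
  "fg_P \<alpha> x = Re (fg_H \<alpha> (Complex x (fg_v \<alpha> x)))"

definition fg_s :: "real \<Rightarrow> real" where
  "fg_s \<alpha> = fg_P \<alpha> (- fg_c \<alpha>)"

definition fg_Q :: "real \<Rightarrow> real \<Rightarrow> real" where
  "fg_Q \<alpha> x = fg_v \<alpha> x / (x\<^sup>2 + (fg_v \<alpha> x)\<^sup>2)"

definition free_gamma_density :: "real \<Rightarrow> real \<Rightarrow> real" where
  "free_gamma_density \<alpha> \<xi> =
     (if \<xi> \<le> fg_s \<alpha> then 0 else 1 / pi * fg_Q \<alpha> (inv (fg_P \<alpha>) \<xi>))"


definition unimodal :: "(real \<Rightarrow> real) \<Rightarrow> bool" where
  "unimodal f \<longleftrightarrow> (\<exists>m. mono_on {..<m} f \<and> antimono_on {m<..} f)"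

end

theory Submission
  imports Defs "HOL-Complex_Analysis.Conformal_Mappings" "HOL-Real_Asymp.Real_Asymp"
begin

text \<open>
  Let \<open>m\<close> be the Gamma distribution with parameter \<open>2\<close>, whose density is \<open>t e\<^sup>-\<^sup>t\<close>.  Then \<open>H z\<close> is
  \<open>z + \<alpha> + \<alpha> G z\<close>, where \<open>G\<close> is the Cauchy transform of \<open>m\<close>, and \<open>F z\<close> is the integral of
  \<open>1 / \<bar>z - t\<bar>\<^sup>2\<close> against \<open>m\<close>, here called the energy of \<open>m\<close> at \<open>z\<close>.  The inequality
  \<open>2 Re (a b) \<le> \<bar>a\<bar>\<^sup>2 + \<bar>b\<bar>\<^sup>2\<close>, with equality only for \<open>a = cnj b\<close>, applied to the two kernels
  \<open>1 / (z - t)\<close> and \<open>1 / (w - t)\<close>, shows that \<open>(H z - H w) / (z - w)\<close> has positive real part for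
  distinct points \<open>z\<close>, \<open>w\<close> of the region on or above the graph of \<open>v\<close>, where \<open>F \<le> 1 / \<alpha>\<close>
  (\<open>Re_fg_H_difference_quotient_pos\<close>).  So \<open>H\<close> is injective on this region, and on its
  boundary, where \<open>H\<close> is real, it induces the strictly increasing map \<open>P\<close>.

  Unimodality.  As \<open>P\<close> is an increasing bijection, the density inherits its shape from \<open>Q\<close>, and
  a continuous function that vanishes at the left end and at infinity is strictly unimodal as soon
  as it takes no positive value three times
  (\<open>strictly_unimodal_if_levels_attained_at_most_twice\<close>).  The points \<open>z = x + i y\<close> with
  \<open>y / \<bar>z\<bar>\<^sup>2 = \<rho>\<close> form a circle through the origin; in terms of the cosine \<open>\<kappa>\<close> of the argument of \<open>z\<close>,
  its points have modulus \<open>sqrt (1 - \<kappa>\<^sup>2) / \<rho>\<close>, and the substitution \<open>t = \<bar>z\<bar> s\<close> turns \<open>F\<close> into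
  \<open>\<integral> s exp (- s sqrt (1 - \<kappa>\<^sup>2) / \<rho>) / (1 - 2 \<kappa> s + s\<^sup>2) ds\<close>.  The integrand is log-convex in \<open>\<kappa>\<close>:
  \<open>sqrt (1 - \<kappa>\<^sup>2)\<close> is concave, and the denominator is affine and positive.  So \<open>F\<close> is a strictly
  convex function of \<open>\<kappa>\<close> on the circle (\<open>circle_integral_strictly_convex\<close>), and the circle meets
  the curve \<open>F = 1 / \<alpha>\<close> at most twice.

  The density.  The classical Gamma distribution has the Levy measure \<open>\<alpha> e\<^sup>-\<^sup>t / t\<close> on the positive
  half-line and no Gaussian part (\<open>gamma_levy_khintchine_triplet\<close>).  Its free cumulant
  transform at \<open>1 / w\<close> is \<open>H w / w - 1\<close>, so \<open>H (1 / G\<^sub>\<nu> u) = u\<close> for \<open>u\<close> in a truncated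
  cone, where \<open>G\<^sub>\<nu>\<close> is the Cauchy transform of a free Gamma distribution \<open>\<nu>\<close>.  By analytic
  continuation this holds in the whole upper half-plane
  (\<open>fg_H_reciprocal_cauchy_transform\<close>).  It forces \<open>1 / G\<^sub>\<nu> u\<close> into the region above the graph of
  \<open>v\<close>, where \<open>H\<close> has a continuous inverse, up to the boundary; hence \<open>1 / G\<^sub>\<nu>\<close> has the boundary
  value \<open>x + i v x\<close> with \<open>x = P\<^sup>-\<^sup>1 \<xi>\<close> at every real \<open>\<xi>\<close>, and Stieltjes inversion reads off the
  density \<open>Q x / \<pi>\<close>.
\<close>

section \<open>Cauchy transforms of finite measures\<close>

text \<open>Dominated convergence along a continuous parameter: in a first countable space, a limit at a
  point can be tested on sequences.\<close>

lemma integral_dominated_convergence_within: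
  fixes f :: "'b::first_countable_topology \<Rightarrow> 'a \<Rightarrow> 'c::{banach, second_countable_topology}"
  assumes [measurable]: "\<And>y. f y \<in> borel_measurable M" "g \<in> borel_measurable M"
    and w: "integrable M w"
    and lim: "AE t in M. ((\<lambda>y. f y t) \<longlongrightarrow> g t) (at x within S)"
    and bound: "eventually (\<lambda>y. AE t in M. norm (f y t) \<le> w t) (at x within S)"
  shows "((\<lambda>y. LINT t|M. f y t) \<longlongrightarrow> (LINT t|M. g t)) (at x within S)"
  unfolding tendsto_at_iff_sequentially
proof (intro allI impI)
  fix X assume X: "\<forall>i. X i \<in> S - {x}" "X \<longlonglongrightarrow> x"
  have lX: "filterlim X (at x within S) sequentially"
    using X by (auto simp: filterlim_at intro!: always_eventually)
  obtain N where N: "\<And>i. i \<ge> N \<Longrightarrow> AE t in M. norm (f (X i) t) \<le> w t"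
    using eventually_compose_filterlim[OF bound lX] unfolding eventually_sequentially by auto
  have "(\<lambda>i. LINT t|M. f (X (i + N)) t) \<longlonglongrightarrow> (LINT t|M. g t)"
  proof (rule integral_dominated_convergence[where w = w])
    show "AE t in M. (\<lambda>i. f (X (i + N)) t) \<longlonglongrightarrow> g t"
      using lim
    proof eventually_elim
      case (elim t)
      have "(\<lambda>i. f (X i) t) \<longlonglongrightarrow> g t"
        using filterlim_compose[OF elim lX] by simp
      then show ?case by (rule LIMSEQ_ignore_initial_segment)
    qed
  qed (use w N in auto)
  then have "(\<lambda>i. LINT t|M. f (X i) t) \<longlonglongrightarrow> (LINT t|M. g t)"
    by (rule LIMSEQ_offset)
  then show "((\<lambda>y. LINT t|M. f y t) \<circ> X) \<longlonglongrightarrow> (LINT t|M. g t)"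
    by (simp add: o_def)
qed

text \<open>A point away from \<open>M\<close> may be real, provided that it lies outside the support of \<open>M\<close>.  This
  matters at the real point \<open>- c\<close>, which belongs to the boundary curve of the Gamma problem.\<close>

definition away_from :: "real measure \<Rightarrow> complex \<Rightarrow> bool" where
  "away_from M z \<longleftrightarrow> (\<exists>\<delta>>0. AE t in M. \<delta> \<le> cmod (z - of_real t))"

definition cauchy_energy :: "real measure \<Rightarrow> complex \<Rightarrow> real" where
  "cauchy_energy M z = (LINT t|M. 1 / (cmod (z - of_real t))\<^sup>2)"

lemma away_from_nonreal:
  assumes "Im z \<noteq> 0"
  shows "away_from M z"
proof -
  have "\<bar>Im z\<bar> \<le> cmod (z - of_real t)" for t
    using abs_Im_le_cmod[of "z - of_real t"] by simp
  then show ?thesis unfolding away_from_def using assms by (intro exI[of _ "\<bar>Im z\<bar>"]) auto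
qed

text \<open>The same bound works at all nearby points, which gives the dominating constants needed for
  continuity and differentiability.\<close>

lemma away_from_nhds:
  assumes "away_from M z"
  obtains \<delta> where "\<delta> > 0" "\<And>w. dist w z < \<delta> \<Longrightarrow> AE t in M. \<delta> \<le> cmod (w - of_real t)"
proof -
  from assms obtain \<epsilon> where \<epsilon>: "\<epsilon> > 0" "AE t in M. \<epsilon> \<le> cmod (z - of_real t)"
    by (auto simp: away_from_def)
  have "AE t in M. \<epsilon> / 2 \<le> cmod (w - of_real t)" if "dist w z < \<epsilon> / 2" for w
    using \<epsilon>(2)
  proof eventually_elim
    case (elim t)
    have "cmod (z - of_real t) \<le> cmod (z - w) + cmod (w - of_real t)"
      using norm_triangle_ineq[of "z - w" "w - of_real t"] by simp
    with elim that show ?case by (simp add: dist_norm norm_minus_commute)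
  qed
  with \<epsilon>(1) show ?thesis by (intro that[of "\<epsilon> / 2"]) auto
qed

context finite_borel_measure
begin

declare M_is_borel [measurable_cong]

lemma integrable_resolvent:
  assumes "away_from M z"
  shows "integrable M (\<lambda>t. 1 / (z - complex_of_real t))"
proof -
  from assms obtain \<delta> where \<delta>: "\<delta> > 0" "AE t in M. \<delta> \<le> cmod (z - of_real t)"
    by (auto simp: away_from_def)
  show ?thesis
  proof (rule integrable_const_bound[where B = "1 / \<delta>"])
    show "AE t in M. cmod (1 / (z - complex_of_real t)) \<le> 1 / \<delta>"
      using \<delta>(2) by eventually_elim
        (use \<delta>(1) in \<open>auto simp: norm_divide intro!: divide_left_mono mult_pos_pos\<close>)
  qed simp
qed

lemma integrable_resolvent_product:
  assumes "away_from M z" "away_from M w"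
  shows "integrable M (\<lambda>t. 1 / ((z - complex_of_real t) * (w - complex_of_real t)))"
proof -
  from assms obtain \<delta> \<epsilon> where \<delta>: "\<delta> > 0" "AE t in M. \<delta> \<le> cmod (z - of_real t)"
    and \<epsilon>: "\<epsilon> > 0" "AE t in M. \<epsilon> \<le> cmod (w - of_real t)"
    by (auto simp: away_from_def)
  show ?thesis
  proof (rule integrable_const_bound[where B = "1 / (\<delta> * \<epsilon>)"])
    show "AE t in M. cmod (1 / ((z - complex_of_real t) * (w - complex_of_real t))) \<le> 1 / (\<delta> * \<epsilon>)"
      using \<delta>(2) \<epsilon>(2)
    proof eventually_elim
      case (elim t)
      then have "\<delta> * \<epsilon> \<le> cmod (z - of_real t) * cmod (w - of_real t)"
        using \<delta>(1) \<epsilon>(1) by (intro mult_mono) auto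
      moreover have "\<delta> * \<epsilon> > 0" using \<delta>(1) \<epsilon>(1) by simp
      ultimately show ?case by (auto simp: norm_divide norm_mult intro!: divide_left_mono)
    qed
  qed simp
qed

lemma integrable_energy:
  assumes "away_from M z"
  shows "integrable M (\<lambda>t. 1 / (cmod (z - complex_of_real t))\<^sup>2)"
  using integrable_norm[OF integrable_resolvent_product[OF assms assms]]
  by (simp add: norm_divide norm_mult power2_eq_square)

lemma Im_cauchy_transform:
  assumes "away_from M z"
  shows "Im (cauchy_transform M z) = - Im z * cauchy_energy M z"
proof -
  have "Im (cauchy_transform M z) = (LINT t|M. Im (1 / (z - complex_of_real t)))"
    unfolding cauchy_transform_def using integrable_resolvent[OF assms] by simp
  also have "\<dots> = (LINT t|M. - Im z * (1 / (cmod (z - complex_of_real t))\<^sup>2))"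
    by (intro Bochner_Integration.integral_cong refl)
       (simp add: Im_divide cmod_power2)
  also have "\<dots> = - Im z * cauchy_energy M z"
    unfolding cauchy_energy_def by (rule integral_mult_right_zero)
  finally show ?thesis .
qed

lemma away_from_imp_AE_ne:
  assumes "away_from M z"
  shows "AE t in M. z \<noteq> complex_of_real t"
  using assms by (auto simp: away_from_def elim!: eventually_mono)

lemma cauchy_transform_diff:
  assumes "away_from M z" "away_from M w"
  shows "cauchy_transform M z - cauchy_transform M w =
    - (z - w) * (LINT t|M. 1 / ((z - complex_of_real t) * (w - complex_of_real t)))"
proof -
  have "cauchy_transform M z - cauchy_transform M w =
      (LINT t|M. 1 / (z - complex_of_real t) - 1 / (w - complex_of_real t))"
    unfolding cauchy_transform_def using integrable_resolvent[OF assms(1)] integrable_resolvent[OF assms(2)] by simp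
  also have "\<dots> = (LINT t|M. - (z - w) * (1 / ((z - complex_of_real t) * (w - complex_of_real t))))"
  proof (rule integral_cong_AE)
    show "AE t in M. 1 / (z - complex_of_real t) - 1 / (w - complex_of_real t) =
        - (z - w) * (1 / ((z - complex_of_real t) * (w - complex_of_real t)))"
      using away_from_imp_AE_ne[OF assms(1)] away_from_imp_AE_ne[OF assms(2)]
      by eventually_elim (simp add: divide_simps)
  qed simp_all
  also have "\<dots> = - (z - w) * (LINT t|M. 1 / ((z - complex_of_real t) * (w - complex_of_real t)))"
    by (rule integral_mult_right_zero)
  finally show ?thesis .
qed

lemma isCont_cauchy_energy:
  assumes "away_from M z"
  shows "isCont (cauchy_energy M) z"
proof -
  obtain \<delta> where \<delta>: "\<delta> > 0" "\<And>w. dist w z < \<delta> \<Longrightarrow> AE t in M. \<delta> \<le> cmod (w - of_real t)"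
    using away_from_nhds[OF assms] by blast
  have "((\<lambda>w. LINT t|M. 1 / (cmod (w - complex_of_real t))\<^sup>2) \<longlongrightarrow>
      (LINT t|M. 1 / (cmod (z - complex_of_real t))\<^sup>2)) (at z)"
  proof (rule integral_dominated_convergence_within[where w = "\<lambda>_. 1 / \<delta>\<^sup>2"])
    show "AE t in M. ((\<lambda>w. 1 / (cmod (w - complex_of_real t))\<^sup>2) \<longlongrightarrow> 1 / (cmod (z - complex_of_real t))\<^sup>2) (at z)"
      using away_from_imp_AE_ne[OF assms] by eventually_elim (auto intro!: tendsto_intros)
    have "AE t in M. norm (1 / (cmod (w - complex_of_real t))\<^sup>2) \<le> 1 / \<delta>\<^sup>2" if "dist w z < \<delta>" for w
      using \<delta>(2)[OF that] by eventually_elim (use \<delta>(1) in \<open>auto intro!: divide_left_mono power_mono mult_pos_pos\<close>)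
    then show "\<forall>\<^sub>F w in at z. AE t in M. norm (1 / (cmod (w - complex_of_real t))\<^sup>2) \<le> 1 / \<delta>\<^sup>2"
      using \<delta>(1) unfolding eventually_at by (intro exI[of _ \<delta>]) auto
  qed auto
  then show ?thesis by (simp add: isCont_def cauchy_energy_def[abs_def])
qed

text \<open>By \<open>cauchy_transform_diff\<close> the difference quotient is itself an integral of a product of two
  kernels, so that differentiability reduces to continuity of such an integral.\<close>

lemma has_field_derivative_cauchy_transform:
  assumes "away_from M z"
  shows "(cauchy_transform M has_field_derivative
    - (LINT t|M. 1 / ((z - complex_of_real t) * (z - complex_of_real t)))) (at z)"
proof -
  obtain \<delta> where \<delta>: "\<delta> > 0" "\<And>w. dist w z < \<delta> \<Longrightarrow> AE t in M. \<delta> \<le> cmod (w - of_real t)"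
    using away_from_nhds[OF assms] by blast
  have "((\<lambda>w. LINT t|M. 1 / ((w - complex_of_real t) * (z - complex_of_real t))) \<longlongrightarrow>
      (LINT t|M. 1 / ((z - complex_of_real t) * (z - complex_of_real t)))) (at z)"
  proof (rule integral_dominated_convergence_within[where w = "\<lambda>_. 1 / (\<delta> * \<delta>)"])
    show "AE t in M. ((\<lambda>w. 1 / ((w - complex_of_real t) * (z - complex_of_real t))) \<longlongrightarrow>
        1 / ((z - complex_of_real t) * (z - complex_of_real t))) (at z)"
      using away_from_imp_AE_ne[OF assms] by eventually_elim (auto intro!: tendsto_intros)
    have "AE t in M. norm (1 / ((w - complex_of_real t) * (z - complex_of_real t))) \<le> 1 / (\<delta> * \<delta>)" if "dist w z < \<delta>" for w
      using \<delta>(2)[OF that] \<delta>(2)[of z, simplified, OF \<delta>(1)]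
    proof eventually_elim
      case (elim t)
      then have "\<delta> * \<delta> \<le> cmod (w - of_real t) * cmod (z - of_real t)"
        using \<delta>(1) by (intro mult_mono) auto
      moreover have "\<delta> * \<delta> > 0" using \<delta>(1) by simp
      ultimately show ?case by (auto simp: norm_divide norm_mult intro!: divide_left_mono)
    qed
    then show "\<forall>\<^sub>F w in at z. AE t in M. norm (1 / ((w - complex_of_real t) * (z - complex_of_real t))) \<le> 1 / (\<delta> * \<delta>)"
      using \<delta>(1) unfolding eventually_at by (intro exI[of _ \<delta>]) auto
  qed auto
  then have lim: "((\<lambda>w. - (LINT t|M. 1 / ((w - complex_of_real t) * (z - complex_of_real t)))) \<longlongrightarrow>
      - (LINT t|M. 1 / ((z - complex_of_real t) * (z - complex_of_real t)))) (at z)"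
    by (rule tendsto_minus)
  have "((\<lambda>w. (cauchy_transform M w - cauchy_transform M z) / (w - z)) \<longlongrightarrow>
      - (LINT t|M. 1 / ((z - complex_of_real t) * (z - complex_of_real t)))) (at z)"
  proof (rule Lim_transform_eventually[OF lim])
    have "away_from M w" if "dist w z < \<delta>" for w
      using \<delta> that by (auto simp: away_from_def)
    then have "- (LINT t|M. 1 / ((w - complex_of_real t) * (z - complex_of_real t))) =
        (cauchy_transform M w - cauchy_transform M z) / (w - z)" if "w \<noteq> z" "dist w z < \<delta>" for w
      using that cauchy_transform_diff[OF _ assms, of w] by (simp add: field_simps)
    then show "\<forall>\<^sub>F w in at z. - (LINT t|M. 1 / ((w - complex_of_real t) * (z - complex_of_real t))) =
        (cauchy_transform M w - cauchy_transform M z) / (w - z)"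
      using \<delta>(1) unfolding eventually_at by (intro exI[of _ \<delta>]) auto
  qed
  then show ?thesis by (simp add: has_field_derivative_iff)
qed

text \<open>With \<open>a\<close>, \<open>b\<close> the two kernels, \<open>\<bar>a\<bar>\<^sup>2 + \<bar>b\<bar>\<^sup>2 - 2 Re (a b) = \<bar>a - cnj b\<bar>\<^sup>2\<close>, and this is
  positive for every \<open>t\<close> unless \<open>z = cnj w\<close>.  Everything about injectivity and monotonicity of
  \<open>H\<close> follows from this strict inequality.\<close>

lemma Re_resolvent_product_less:
  assumes "away_from M z" "away_from M w" "z \<noteq> cnj w" "emeasure M (space M) \<noteq> 0"
  shows "Re (LINT t|M. 1 / ((z - complex_of_real t) * (w - complex_of_real t))) <
    (cauchy_energy M z + cauchy_energy M w) / 2"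
proof -
  have "Re (LINT t|M. 1 / ((z - complex_of_real t) * (w - complex_of_real t))) =
      (LINT t|M. Re (1 / ((z - complex_of_real t) * (w - complex_of_real t))))"
    using integrable_resolvent_product[OF assms(1,2)] by simp
  also have "\<dots> < (LINT t|M. (1 / (cmod (z - complex_of_real t))\<^sup>2 + 1 / (cmod (w - complex_of_real t))\<^sup>2) / 2)"
  proof (rule integral_less_AE_space)
    show "integrable M (\<lambda>t. Re (1 / ((z - complex_of_real t) * (w - complex_of_real t))))"
      using integrable_resolvent_product[OF assms(1,2)] by simp
    show "integrable M (\<lambda>t. (1 / (cmod (z - complex_of_real t))\<^sup>2 + 1 / (cmod (w - complex_of_real t))\<^sup>2) / 2)"
      using integrable_energy[OF assms(1)] integrable_energy[OF assms(2)] by simp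
    show "AE t in M. Re (1 / ((z - complex_of_real t) * (w - complex_of_real t))) <
        (1 / (cmod (z - complex_of_real t))\<^sup>2 + 1 / (cmod (w - complex_of_real t))\<^sup>2) / 2"
      using away_from_imp_AE_ne[OF assms(1)] away_from_imp_AE_ne[OF assms(2)]
    proof eventually_elim
      case (elim t)
      define a where "a = 1 / (z - complex_of_real t)"
      define b where "b = 1 / (w - complex_of_real t)"
      have "a \<noteq> cnj b"
        using elim assms(3) by (auto simp: a_def b_def divide_simps)
      then have "0 < (cmod (a - cnj b))\<^sup>2" by simp
      also have "\<dots> = (cmod a)\<^sup>2 + (cmod b)\<^sup>2 - 2 * Re (a * b)"
        by (simp add: cmod_power2) (simp add: power2_eq_square algebra_simps)
      finally have "Re (a * b) < ((cmod a)\<^sup>2 + (cmod b)\<^sup>2) / 2" by simp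
      then show ?case by (simp add: a_def b_def norm_divide power_divide)
    qed
  qed fact
  also have "\<dots> = (cauchy_energy M z + cauchy_energy M w) / 2"
    unfolding cauchy_energy_def using integrable_energy[OF assms(1)] integrable_energy[OF assms(2)] by simp
  finally show ?thesis .
qed

lemma norm_cauchy_transform_le:
  assumes "away_from M z"
  shows "cmod (cauchy_transform M z) \<le> (measure M (space M) + cauchy_energy M z) / 2"
proof -
  have "cmod (cauchy_transform M z) \<le> (LINT t|M. cmod (1 / (z - complex_of_real t)))"
    unfolding cauchy_transform_def by (rule integral_norm_bound)
  also have "\<dots> \<le> (LINT t|M. (1 + 1 / (cmod (z - complex_of_real t))\<^sup>2) / 2)"
  proof (rule integral_mono)
    show "integrable M (\<lambda>t. cmod (1 / (z - complex_of_real t)))"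
      using integrable_resolvent[OF assms] by (rule integrable_norm)
    show "integrable M (\<lambda>t. (1 + 1 / (cmod (z - complex_of_real t))\<^sup>2) / 2)"
      using integrable_energy[OF assms] by simp
    fix t
    have "2 * x \<le> 1 + x\<^sup>2" for x :: real
      using zero_le_power2[of "x - 1"] by (simp add: power2_eq_square algebra_simps)
    from this[of "cmod (1 / (z - complex_of_real t))"]
    show "cmod (1 / (z - complex_of_real t)) \<le> (1 + 1 / (cmod (z - complex_of_real t))\<^sup>2) / 2"
      by (simp add: norm_divide power_divide)
  qed
  also have "\<dots> = (measure M (space M) + cauchy_energy M z) / 2"
    unfolding cauchy_energy_def using integrable_energy[OF assms] by simp
  finally show ?thesis .
qed

end

section \<open>Gamma distributions\<close>

definition gamma_density :: "real \<Rightarrow> real \<Rightarrow> real" where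
  "gamma_density a t = indicator {0..} t * (t powr (a - 1) * exp (- t) / Gamma a)"

lemma borel_measurable_gamma_density [measurable]: "gamma_density a \<in> borel_measurable borel"
  unfolding gamma_density_def[abs_def] by measurable

lemma gamma_density_nonneg: "a > 0 \<Longrightarrow> gamma_density a t \<ge> 0"
  by (simp add: gamma_density_def Gamma_real_pos less_imp_le)

lemma gamma_distribution_eq: "gamma_distribution a = density lborel (\<lambda>t. ennreal (gamma_density a t))"
  by (simp add: gamma_distribution_def gamma_density_def)

lemma sets_gamma_distribution [measurable_cong, simp]: "sets (gamma_distribution a) = sets borel"
  by (simp add: gamma_distribution_def)

lemma space_gamma_distribution [simp]: "space (gamma_distribution a) = UNIV"
  by (simp add: gamma_distribution_def)

lemma prob_space_gamma_distribution:
  assumes "a > 0"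
  shows "prob_space (gamma_distribution a)"
proof
  have "((\<lambda>t. t powr (a - 1) / exp t / Gamma a) has_integral Gamma a / Gamma a) {0..}"
    using Gamma_integral_real[OF assms] by (rule has_integral_divide)
  then have "((\<lambda>t. t powr (a - 1) * exp (- t) / Gamma a) has_integral 1) {0..}"
    using Gamma_real_pos[OF assms] by (simp add: exp_minus field_simps)
  then have "(\<integral>\<^sup>+t. ennreal (t powr (a - 1) * exp (- t) / Gamma a) * indicator {0..} t \<partial>lborel) = ennreal 1"
    using Gamma_real_pos[OF assms] by (intro nn_integral_has_integral_lebesgue') auto
  also have "(\<integral>\<^sup>+t. ennreal (t powr (a - 1) * exp (- t) / Gamma a) * indicator {0..} t \<partial>lborel) =
      (\<integral>\<^sup>+t. ennreal (gamma_density a t) \<partial>lborel)"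
    by (intro nn_integral_cong) (auto simp: gamma_density_def indicator_def)
  finally show "emeasure (gamma_distribution a) (space (gamma_distribution a)) = 1"
    by (simp add: gamma_distribution_eq emeasure_density)
qed

lemma integral_gamma_distribution:
  fixes f :: "real \<Rightarrow> 'a::{banach, second_countable_topology}"
  assumes "a > 0" and [measurable]: "f \<in> borel_measurable borel"
  shows "(LINT t|gamma_distribution a. f t) = (LINT t|lborel. gamma_density a t *\<^sub>R f t)"
  unfolding gamma_distribution_eq using gamma_density_nonneg[OF assms(1)]
  by (subst integral_density) auto

lemma integrable_gamma_distribution:
  fixes f :: "real \<Rightarrow> 'a::{banach, second_countable_topology}"
  assumes "a > 0" and [measurable]: "f \<in> borel_measurable borel"
  shows "integrable (gamma_distribution a) f \<longleftrightarrow> integrable lborel (\<lambda>t. gamma_density a t *\<^sub>R f t)"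
  unfolding gamma_distribution_eq using gamma_density_nonneg[OF assms(1)]
  by (subst integrable_density) auto

lemma AE_gamma_distribution_nonneg: "AE t in gamma_distribution a. t \<ge> 0"
  unfolding gamma_distribution_eq
  by (subst AE_density) (auto simp: gamma_density_def indicator_def split: if_splits)

lemma gamma_density_2: "gamma_density 2 t = indicator {0..} t * (t * exp (- t))"
  using Gamma_fact[of 1, where ?'a = real]
  by (auto simp: gamma_density_def indicator_def numeral_2_eq_2[symmetric])

interpretation gamma2: prob_space "gamma_distribution 2"
  by (rule prob_space_gamma_distribution) simp

interpretation gamma2: finite_borel_measure "gamma_distribution 2"
  by unfold_locales simp

section \<open>The energy of the Gamma distribution and the boundary curve\<close>

lemma fg_F_eq_energy: "fg_F = cauchy_energy (gamma_distribution 2)"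
  by (rule ext) (simp add: fg_F_def cauchy_energy_def integral_gamma_distribution gamma_density_2
      set_lebesgue_integral_def mult.assoc)

lemma fg_H_eq: "fg_H \<alpha> z = z + of_real \<alpha> + of_real \<alpha> * cauchy_transform (gamma_distribution 2) z"
proof -
  have "(LINT t:{0..}|lborel. complex_of_real (t * exp (- t)) / (z - complex_of_real t)) =
      (LINT t|lborel. gamma_density 2 t *\<^sub>R (1 / (z - complex_of_real t)))"
    unfolding set_lebesgue_integral_def
    by (intro Bochner_Integration.integral_cong refl)
       (simp add: gamma_density_2 indicator_def scaleR_conv_of_real)
  then show ?thesis
    by (simp add: fg_H_def cauchy_transform_def integral_gamma_distribution)
qed

lemma away_from_gamma:
  assumes "z \<notin> \<real>\<^sub>\<ge>\<^sub>0"
  shows "away_from (gamma_distribution a) z"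
proof -
  from assms obtain \<delta> where \<delta>: "\<delta> > 0" "\<And>w. dist z w < \<delta> \<Longrightarrow> w \<notin> \<real>\<^sub>\<ge>\<^sub>0"
    using closed_nonneg_Reals_complex[unfolded closed_def open_dist]
    by (metis Compl_iff dist_commute)
  have "AE t in gamma_distribution a. \<delta> \<le> cmod (z - of_real t)"
    using AE_gamma_distribution_nonneg
  proof eventually_elim
    case (elim t)
    then have "complex_of_real t \<in> \<real>\<^sub>\<ge>\<^sub>0" by simp
    with \<delta>(2)[of "of_real t"] show ?case by (auto simp: dist_norm simp flip: not_less)
  qed
  with \<delta>(1) show ?thesis by (auto simp: away_from_def)
qed

lemma isCont_fg_F: "z \<notin> \<real>\<^sub>\<ge>\<^sub>0 \<Longrightarrow> isCont fg_F z"
  unfolding fg_F_eq_energy by (intro gamma2.isCont_cauchy_energy away_from_gamma)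

lemma fg_F_strict_antimono:
  assumes "z \<notin> \<real>\<^sub>\<ge>\<^sub>0" "w \<notin> \<real>\<^sub>\<ge>\<^sub>0"
    and "\<And>t. t \<ge> 0 \<Longrightarrow> cmod (z - of_real t) < cmod (w - of_real t)"
  shows "fg_F w < fg_F z"
  unfolding fg_F_eq_energy cauchy_energy_def
proof (rule gamma2.integral_less_AE_space)
  show "AE t in gamma_distribution 2. 1 / (cmod (w - complex_of_real t))\<^sup>2 < 1 / (cmod (z - complex_of_real t))\<^sup>2"
    using AE_gamma_distribution_nonneg
  proof eventually_elim
    case (elim t)
    then have "z \<noteq> of_real t" using assms(1) by auto
    then have "(cmod (z - complex_of_real t))\<^sup>2 > 0" by simp
    moreover have "(cmod (z - complex_of_real t))\<^sup>2 < (cmod (w - complex_of_real t))\<^sup>2"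
      using assms(3)[OF elim] by (intro power_strict_mono) auto
    ultimately show ?case by (intro divide_strict_left_mono mult_pos_pos) linarith+
  qed
qed (use assms gamma2.emeasure_space_1 in \<open>auto intro!: gamma2.integrable_energy away_from_gamma\<close>)

lemma fg_F_le:
  assumes "\<delta> > 0" "\<And>t. t \<ge> 0 \<Longrightarrow> \<delta> \<le> cmod (z - of_real t)"
  shows "fg_F z \<le> 1 / \<delta>\<^sup>2"
proof -
  have "z \<notin> \<real>\<^sub>\<ge>\<^sub>0" using assms by (force elim!: nonneg_Reals_cases)
  then have i: "integrable (gamma_distribution 2) (\<lambda>t. 1 / (cmod (z - complex_of_real t))\<^sup>2)"
    by (intro gamma2.integrable_energy away_from_gamma)
  have "fg_F z \<le> (LINT t|gamma_distribution 2. 1 / \<delta>\<^sup>2)"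
    unfolding fg_F_eq_energy cauchy_energy_def
  proof (rule integral_mono_AE[OF i])
    show "AE t in gamma_distribution 2. 1 / (cmod (z - complex_of_real t))\<^sup>2 \<le> 1 / \<delta>\<^sup>2"
      using AE_gamma_distribution_nonneg
    proof eventually_elim
      case (elim t)
      have "0 < cmod (z - of_real t)" using assms(1) assms(2)[OF elim] by linarith
      then show ?case using assms(1) assms(2)[OF elim]
        by (intro divide_left_mono power_mono mult_pos_pos) auto
    qed
  qed simp
  then show ?thesis by (simp add: gamma2.prob_space[simplified])
qed

text \<open>At a point of the support \<open>[0, \<infinity>)\<close> the energy is infinite.  The divergence is only
  logarithmic at \<open>x = 0\<close>, where the weight \<open>t e\<^sup>-\<^sup>t\<close> vanishes to first order, and a logarithmic bound
  suffices for all \<open>x\<close>: on \<open>[x + \<epsilon>, x + 1]\<close> the distance \<open>\<bar>z - t\<bar>\<close> is at most \<open>2 (t - x)\<close>, and the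
  weight is at least \<open>(t - x) exp (- x - 1)\<close>.\<close>

lemma fg_F_blow_up:
  assumes "z \<notin> \<real>\<^sub>\<ge>\<^sub>0" "x \<ge> 0" "cmod (z - of_real x) \<le> \<epsilon>" "0 < \<epsilon>" "\<epsilon> \<le> 1"
  shows "fg_F z \<ge> exp (- x - 1) / 4 * ln (1 / \<epsilon>)"
proof -
  define K where "K = exp (- x - 1) / 4"
  have K: "K > 0" by (simp add: K_def)
  have der: "((\<lambda>t. K * ln (t - x)) has_real_derivative K / (t - x)) (at t)" if "x + \<epsilon> \<le> t" for t
    using that assms(4) by (auto intro!: derivative_eq_intros)
  have cont: "isCont (\<lambda>t. K / (t - x)) t" if "x + \<epsilon> \<le> t" for t
    using that assms(4) by (intro continuous_intros) auto
  have "K * ln (1 / \<epsilon>) = K * ln (x + 1 - x) - K * ln (x + \<epsilon> - x)"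
    using assms(4) by (simp add: ln_div)
  also have "\<dots> = (LINT t|lborel. K / (t - x) * indicator {x + \<epsilon>..x + 1} t)"
    by (rule integral_FTC_Icc_real[symmetric]) (use assms der cont in auto)
  also have "\<dots> \<le> (LINT t|lborel. gamma_density 2 t *\<^sub>R (1 / (cmod (z - complex_of_real t))\<^sup>2))"
  proof (rule integral_mono)
    show "integrable lborel (\<lambda>t. K / (t - x) * indicator {x + \<epsilon>..x + 1} t)"
      using has_bochner_integral_FTC_Icc_real[of "x + \<epsilon>" "x + 1" "\<lambda>t. K * ln (t - x)" "\<lambda>t. K / (t - x)"]
        assms der cont by (auto simp: has_bochner_integral_iff)
    show "integrable lborel (\<lambda>t. gamma_density 2 t *\<^sub>R (1 / (cmod (z - complex_of_real t))\<^sup>2))"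
      using gamma2.integrable_energy[OF away_from_gamma[OF assms(1)]] by (subst (asm) integrable_gamma_distribution) auto
    fix t :: real
    show "K / (t - x) * indicator {x + \<epsilon>..x + 1} t \<le> gamma_density 2 t *\<^sub>R (1 / (cmod (z - complex_of_real t))\<^sup>2)"
    proof (cases "t \<in> {x + \<epsilon>..x + 1}")
      case True
      then have t: "t - x \<ge> \<epsilon>" "t \<le> x + 1" "t \<ge> 0" "t > x" using assms by auto
      have "z \<noteq> of_real t" using assms(1) t by auto
      then have pos: "cmod (z - complex_of_real t) > 0" by simp
      have "cmod (z - complex_of_real t) \<le> cmod (z - of_real x) + cmod (of_real x - complex_of_real t)"
        using norm_triangle_ineq[of "z - of_real x" "of_real x - complex_of_real t"] by simp
      also have "cmod (of_real x - complex_of_real t) = t - x"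
        using t(4) by (metis abs_minus_commute abs_of_pos diff_gt_0_iff_gt norm_of_real of_real_diff)
      finally have "cmod (z - complex_of_real t) \<le> 2 * (t - x)" using t(1) assms(3) by argo
      then have le: "(cmod (z - complex_of_real t))\<^sup>2 \<le> 4 * (t - x)\<^sup>2"
        using power_mono[of "cmod (z - complex_of_real t)" "2 * (t - x)" 2]
        unfolding power_mult_distrib by simp
      have "K / (t - x) = (t - x) * exp (- x - 1) / (4 * (t - x)\<^sup>2)"
        using t(4) by (simp add: K_def power2_eq_square)
      also have "\<dots> \<le> (t * exp (- t)) / (4 * (t - x)\<^sup>2)"
        using t assms(2) by (intro divide_right_mono mult_mono) auto
      also have "\<dots> \<le> (t * exp (- t)) / (cmod (z - complex_of_real t))\<^sup>2"
        using le pos t by (intro divide_left_mono) auto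
      finally show ?thesis using True t by (simp add: gamma_density_2)
    next
      case False
      then show ?thesis by (simp add: gamma_density_nonneg)
    qed
  qed
  also have "\<dots> = fg_F z"
    by (simp add: fg_F_eq_energy cauchy_energy_def integral_gamma_distribution)
  finally show ?thesis by (simp add: K_def)
qed

text \<open>This keeps limits of points with bounded energy off the half-line \<open>[0, \<infinity>)\<close>.\<close>

lemma fg_F_unbounded_near:
  assumes "x \<ge> 0"
  obtains \<epsilon> where "\<epsilon> > 0" "\<And>z. z \<notin> \<real>\<^sub>\<ge>\<^sub>0 \<Longrightarrow> cmod (z - of_real x) \<le> \<epsilon> \<Longrightarrow> fg_F z > C"
proof
  \<comment> \<open>The radius \<open>exp (- L)\<close> makes the lower bound of \<open>fg_F_blow_up\<close> linear in \<open>L\<close>.\<close>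
  define L where "L = \<bar>C\<bar> * 4 / exp (- x - 1) + 1"
  have L: "L > 0" by (auto simp: L_def intro!: add_nonneg_pos)
  show "exp (- L) > 0" by simp
  fix z assume "z \<notin> \<real>\<^sub>\<ge>\<^sub>0" "cmod (z - of_real x) \<le> exp (- L)"
  then have "fg_F z \<ge> exp (- x - 1) / 4 * ln (1 / exp (- L))"
    using L assms by (intro fg_F_blow_up) auto
  also have "ln (1 / exp (- L)) = L" by (simp add: ln_div)
  also have "exp (- x - 1) / 4 * L = \<bar>C\<bar> + exp (- x - 1) / 4"
    by (simp add: L_def field_simps)
  finally show "fg_F z > C"
    using exp_gt_zero[of "- x - 1"] by linarith
qed

lemma negative_real_slit: "x < 0 \<Longrightarrow> complex_of_real x \<notin> \<real>\<^sub>\<ge>\<^sub>0"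
  by (simp add: complex_nonneg_Reals_iff)

lemma fg_F_negative_strict_mono:
  assumes "x < y" "y < 0"
  shows "fg_F (of_real x) < fg_F (of_real y)"
proof (rule fg_F_strict_antimono)
  fix t :: real assume "t \<ge> 0"
  then show "cmod (of_real y - of_real t) < cmod (of_real x - of_real t)"
    using assms by (simp add: of_real_diff[symmetric] norm_of_real del: of_real_diff)
qed (use assms in \<open>auto intro: negative_real_slit\<close>)

lemma fg_F_vertical_strict_antimono:
  assumes "0 \<le> y" "y < y'" "y > 0 \<or> x < 0"
  shows "fg_F (Complex x y') < fg_F (Complex x y)"
proof (rule fg_F_strict_antimono)
  fix t :: real
  have "y\<^sup>2 < y'\<^sup>2" using assms by (intro power_strict_mono) auto
  then show "cmod (Complex x y - of_real t) < cmod (Complex x y' - of_real t)"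
    by (simp add: cmod_def)
qed (use assms in \<open>auto simp: complex_nonneg_Reals_iff\<close>)

lemma fg_F_le_inverse_Im_square: "y > 0 \<Longrightarrow> fg_F (Complex x y) \<le> 1 / y\<^sup>2"
  by (rule fg_F_le) (auto intro: order_trans[OF _ abs_Im_le_cmod])

text \<open>The points on or above the graph of \<open>v\<close>.  The description by \<open>F\<close> has two advantages: it treats
  both parts of the boundary, the half-line up to \<open>- c\<close> and the curve above the real axis, alike,
  and it is visibly closed, by continuity of \<open>F\<close> and its blow-up on \<open>[0, \<infinity>)\<close>.\<close>

definition fg_region :: "real \<Rightarrow> complex set" where
  "fg_region \<alpha> = {z. Im z \<ge> 0 \<and> z \<notin> \<real>\<^sub>\<ge>\<^sub>0 \<and> fg_F z \<le> 1 / \<alpha>}"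

context
  fixes \<alpha> :: real
  assumes \<alpha>: "\<alpha> > 0"
begin

text \<open>On the negative half-line \<open>F\<close> increases strictly and continuously, from below \<open>1 / \<alpha>\<close>
  far to the left to \<open>\<infinity>\<close> at the origin.\<close>

lemma fg_c_ex1: "\<exists>!c. c > 0 \<and> fg_F (of_real (- c)) = 1 / \<alpha>"
proof -
  obtain \<epsilon> where \<epsilon>: "\<epsilon> > 0" "\<And>z. z \<notin> \<real>\<^sub>\<ge>\<^sub>0 \<Longrightarrow> cmod (z - of_real 0) \<le> \<epsilon> \<Longrightarrow> fg_F z > 1 / \<alpha>"
    using fg_F_unbounded_near[of 0 "1 / \<alpha>"] by auto
  define b where "b = max \<epsilon> (sqrt \<alpha>)"
  have b: "b \<ge> \<epsilon>" "b > 0" "b\<^sup>2 \<ge> \<alpha>"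
    using \<epsilon>(1) \<alpha> power_mono[of "sqrt \<alpha>" b 2] by (auto simp: b_def)
  have "fg_F (of_real (- b)) \<le> 1 / b\<^sup>2"
  proof (rule fg_F_le)
    fix t :: real assume "t \<ge> 0"
    then show "b \<le> cmod (of_real (- b) - of_real t)"
      using b(2) by (simp add: of_real_diff[symmetric] norm_of_real del: of_real_diff of_real_minus)
  qed fact
  also have "\<dots> \<le> 1 / \<alpha>" using b \<alpha> by (intro divide_left_mono) auto
  finally have hi: "fg_F (of_real (- b)) \<le> 1 / \<alpha>" .
  have lo: "1 / \<alpha> \<le> fg_F (of_real (- \<epsilon>))"
    using \<epsilon>(2)[of "of_real (- \<epsilon>)"] \<epsilon>(1) negative_real_slit[of "- \<epsilon>"] by auto
  have "isCont (\<lambda>x. fg_F (of_real (- x))) x" if "x \<ge> \<epsilon>" for x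
    by (rule isCont_o2[where f = "\<lambda>x. of_real (- x)"])
       (use that \<epsilon>(1) negative_real_slit[of "- x"] in \<open>auto intro!: continuous_intros isCont_fg_F\<close>)
  then have "\<exists>c\<ge>\<epsilon>. c \<le> b \<and> fg_F (of_real (- c)) = 1 / \<alpha>"
    using hi lo b(1) by (intro IVT2) blast+
  then obtain c where c: "\<epsilon> \<le> c" "c \<le> b" "fg_F (of_real (- c)) = 1 / \<alpha>" by blast
  show ?thesis
  proof (rule ex1I[of _ c])
    show "c > 0 \<and> fg_F (of_real (- c)) = 1 / \<alpha>" using c \<epsilon>(1) by auto
    fix c' assume "c' > 0 \<and> fg_F (of_real (- c')) = 1 / \<alpha>"
    then show "c' = c"
      using c \<epsilon>(1) fg_F_negative_strict_mono[of "- c" "- c'"] fg_F_negative_strict_mono[of "- c'" "- c"]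
      by (cases c c' rule: linorder_cases) auto
  qed
qed

lemma fg_c_pos: "fg_c \<alpha> > 0"
  and fg_F_at_c: "fg_F (of_real (- fg_c \<alpha>)) = 1 / \<alpha>"
  using theI'[OF fg_c_ex1] by (auto simp: fg_c_def)

lemma fg_F_negative_le_iff:
  assumes "x < 0"
  shows "fg_F (of_real x) \<le> 1 / \<alpha> \<longleftrightarrow> x \<le> - fg_c \<alpha>"
  using assms fg_F_at_c fg_c_pos fg_F_negative_strict_mono[of x "- fg_c \<alpha>"]
    fg_F_negative_strict_mono[of "- fg_c \<alpha>" x]
  by (cases x "- fg_c \<alpha>" rule: linorder_cases) auto

text \<open>On a vertical half-line \<open>F\<close> decreases strictly and is at most \<open>1 / y\<^sup>2\<close>.  Close to the real axis
  it exceeds \<open>1 / \<alpha>\<close>: for \<open>x \<ge> 0\<close> by blow-up, for \<open>- c < x < 0\<close> by continuity at the real point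
  \<open>x\<close>.\<close>

lemma fg_v_ex1:
  assumes "x > - fg_c \<alpha>"
  shows "\<exists>!y. y > 0 \<and> fg_F (Complex x y) = 1 / \<alpha>"
proof -
  have "\<exists>\<epsilon>>0. fg_F (Complex x \<epsilon>) > 1 / \<alpha>"
  proof (cases "x \<ge> 0")
    case True
    then obtain \<epsilon> where \<epsilon>: "\<epsilon> > 0" "\<And>z. z \<notin> \<real>\<^sub>\<ge>\<^sub>0 \<Longrightarrow> cmod (z - of_real x) \<le> \<epsilon> \<Longrightarrow> fg_F z > 1 / \<alpha>"
      using fg_F_unbounded_near[of x "1 / \<alpha>"] by auto
    moreover have "Complex x \<epsilon> - of_real x = \<i> * of_real \<epsilon>" by (simp add: complex_eq_iff)
    ultimately show ?thesis
      by (intro exI[of _ \<epsilon>]) (auto simp: complex_nonneg_Reals_iff norm_mult)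
  next
    case False
    then have F: "fg_F (of_real x) > 1 / \<alpha>" using fg_F_negative_le_iff[of x] assms by auto
    have "isCont (\<lambda>y. fg_F (Complex x y)) 0"
      unfolding Complex_eq
      by (rule isCont_o2[where f = "\<lambda>y. of_real x + \<i> * of_real y"])
         (use False in \<open>auto intro!: continuous_intros isCont_fg_F simp: complex_nonneg_Reals_iff\<close>)
    then have "((\<lambda>y. fg_F (Complex x y)) \<longlongrightarrow> fg_F (of_real x)) (at_right 0)"
      by (simp add: isCont_def complex_of_real_def filterlim_at_split)
    from order_tendstoD(1)[OF this F] have "\<forall>\<^sub>F y in at_right 0. fg_F (Complex x y) > 1 / \<alpha>" .
    moreover have "\<forall>\<^sub>F y in at_right (0::real). y > 0" by (simp add: eventually_at_right_less)
    ultimately have "\<forall>\<^sub>F y in at_right 0. y > 0 \<and> fg_F (Complex x y) > 1 / \<alpha>"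
      by eventually_elim auto
    then show ?thesis using eventually_happens' trivial_limit_at_right_real by blast
  qed
  then obtain \<epsilon> where \<epsilon>: "\<epsilon> > 0" "fg_F (Complex x \<epsilon>) > 1 / \<alpha>" by blast
  define b where "b = max \<epsilon> (sqrt \<alpha>)"
  have b: "b \<ge> \<epsilon>" "b > 0" "b\<^sup>2 \<ge> \<alpha>"
    using \<epsilon>(1) \<alpha> power_mono[of "sqrt \<alpha>" b 2] by (auto simp: b_def)
  have "fg_F (Complex x b) \<le> 1 / b\<^sup>2" using b by (intro fg_F_le_inverse_Im_square) auto
  also have "\<dots> \<le> 1 / \<alpha>" using b \<alpha> by (intro divide_left_mono) auto
  finally have hi: "fg_F (Complex x b) \<le> 1 / \<alpha>" .
  have "isCont (\<lambda>y. fg_F (Complex x y)) y" if "y \<ge> \<epsilon>" for y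
    unfolding Complex_eq
    by (rule isCont_o2[where f = "\<lambda>y. of_real x + \<i> * of_real y"])
       (use that \<epsilon>(1) in \<open>auto intro!: continuous_intros isCont_fg_F simp: complex_nonneg_Reals_iff\<close>)
  then have "\<exists>y\<ge>\<epsilon>. y \<le> b \<and> fg_F (Complex x y) = 1 / \<alpha>"
    using hi less_imp_le[OF \<epsilon>(2)] b(1) by (intro IVT2) blast+
  then obtain y where y: "\<epsilon> \<le> y" "y \<le> b" "fg_F (Complex x y) = 1 / \<alpha>" by blast
  show ?thesis
  proof (rule ex1I[of _ y])
    show "y > 0 \<and> fg_F (Complex x y) = 1 / \<alpha>" using y \<epsilon>(1) by auto
    fix y' assume "y' > 0 \<and> fg_F (Complex x y') = 1 / \<alpha>"
    then show "y' = y"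
      using y \<epsilon>(1) fg_F_vertical_strict_antimono[of y y' x] fg_F_vertical_strict_antimono[of y' y x]
      by (cases y y' rule: linorder_cases) auto
  qed
qed

lemma fg_v_left: "x \<le> - fg_c \<alpha> \<Longrightarrow> fg_v \<alpha> x = 0"
  by (simp add: fg_v_def)

lemma fg_v_pos: "x > - fg_c \<alpha> \<Longrightarrow> fg_v \<alpha> x > 0"
  and fg_F_at_v: "x > - fg_c \<alpha> \<Longrightarrow> fg_F (Complex x (fg_v \<alpha> x)) = 1 / \<alpha>"
  using theI'[OF fg_v_ex1] by (auto simp: fg_v_def)

lemma fg_v_nonneg: "fg_v \<alpha> x \<ge> 0"
  using fg_v_left[of x] fg_v_pos[of x] by (cases "x \<le> - fg_c \<alpha>") auto

lemma fg_curve_in_region: "Complex x (fg_v \<alpha> x) \<in> fg_region \<alpha>"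
proof (cases "x \<le> - fg_c \<alpha>")
  case True
  then show ?thesis
    using fg_v_left[OF True] fg_c_pos fg_F_negative_le_iff[of x]
    by (auto simp: fg_region_def complex_nonneg_Reals_iff complex_of_real_def)
next
  case False
  then show ?thesis
    using fg_v_pos[of x] fg_F_at_v[of x] by (auto simp: fg_region_def complex_nonneg_Reals_iff)
qed

lemma closed_fg_region: "closed (fg_region \<alpha>)"
  unfolding closed_sequential_limits
proof (intro allI impI, elim conjE)
  fix X l assume X: "\<forall>n. X n \<in> fg_region \<alpha>" "X \<longlonglongrightarrow> l"
  have Im: "Im l \<ge> 0"
    using tendsto_Im[OF X(2)] X(1) by (intro LIMSEQ_le_const[of "\<lambda>n. Im (X n)"]) (auto simp: fg_region_def)
  have l: "l \<notin> \<real>\<^sub>\<ge>\<^sub>0"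
  proof
    assume "l \<in> \<real>\<^sub>\<ge>\<^sub>0"
    then obtain x where x: "x \<ge> 0" "l = of_real x" by (auto elim: nonneg_Reals_cases)
    obtain \<epsilon> where \<epsilon>: "\<epsilon> > 0" "\<And>z. z \<notin> \<real>\<^sub>\<ge>\<^sub>0 \<Longrightarrow> cmod (z - of_real x) \<le> \<epsilon> \<Longrightarrow> fg_F z > 1 / \<alpha>"
      using fg_F_unbounded_near[OF x(1), of "1 / \<alpha>"] by auto
    from X(2) \<epsilon>(1) obtain n where "dist (X n) l < \<epsilon>" by (metis LIMSEQ_iff dist_norm order_refl)
    with \<epsilon>(2)[of "X n"] x(2) have "X n \<in> \<real>\<^sub>\<ge>\<^sub>0 \<or> fg_F (X n) > 1 / \<alpha>" by (auto simp: dist_norm)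
    moreover have "X n \<in> fg_region \<alpha>" using X(1) by blast
    ultimately show False by (auto simp: fg_region_def)
  qed
  have "(\<lambda>n. fg_F (X n)) \<longlonglongrightarrow> fg_F l"
    using isCont_tendsto_compose[OF isCont_fg_F[OF l] X(2)] .
  then have "fg_F l \<le> 1 / \<alpha>"
    using X(1) by (intro LIMSEQ_le_const2[of "\<lambda>n. fg_F (X n)"]) (auto simp: fg_region_def)
  with Im l show "l \<in> fg_region \<alpha>" by (simp add: fg_region_def)
qed

section \<open>The map \<open>H\<close> on and above the curve\<close>

lemma Im_fg_H:
  assumes "z \<notin> \<real>\<^sub>\<ge>\<^sub>0"
  shows "Im (fg_H \<alpha> z) = Im z * (1 - \<alpha> * fg_F z)"
  using gamma2.Im_cauchy_transform[OF away_from_gamma[OF assms]]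
  by (simp add: fg_H_eq fg_F_eq_energy algebra_simps)

lemma isCont_fg_H: "z \<notin> \<real>\<^sub>\<ge>\<^sub>0 \<Longrightarrow> isCont (fg_H \<alpha>) z"
  unfolding fg_H_eq[abs_def]
  by (intro continuous_intros DERIV_isCont[OF gamma2.has_field_derivative_cauchy_transform] away_from_gamma)

lemma holomorphic_on_fg_H: "fg_H \<alpha> holomorphic_on - \<real>\<^sub>\<ge>\<^sub>0"
proof -
  have "cauchy_transform (gamma_distribution 2) holomorphic_on - \<real>\<^sub>\<ge>\<^sub>0"
    unfolding holomorphic_on_def field_differentiable_def
    by (metis ComplD away_from_gamma gamma2.has_field_derivative_cauchy_transform has_field_derivative_at_within)
  then show ?thesis unfolding fg_H_eq[abs_def] by (intro holomorphic_intros)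
qed

lemma fg_H_curve: "fg_H \<alpha> (Complex x (fg_v \<alpha> x)) = of_real (fg_P \<alpha> x)"
proof -
  have "Complex x (fg_v \<alpha> x) \<notin> \<real>\<^sub>\<ge>\<^sub>0" using fg_curve_in_region by (auto simp: fg_region_def)
  from Im_fg_H[OF this] have "Im (fg_H \<alpha> (Complex x (fg_v \<alpha> x))) = 0"
    using fg_v_left[of x] fg_F_at_v[of x] \<alpha> by (cases "x \<le> - fg_c \<alpha>") auto
  then show ?thesis by (simp add: complex_eq_iff fg_P_def)
qed

text \<open>The quotient is \<open>1 - \<alpha> I\<close>, where \<open>I\<close> is the integral of the product of the two kernels, and
  \<open>Re I\<close> is strictly below the mean of \<open>F z\<close> and \<open>F w\<close>, hence below \<open>1 / \<alpha>\<close>.\<close>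

lemma Re_fg_H_difference_quotient_pos:
  assumes "z \<in> fg_region \<alpha>" "w \<in> fg_region \<alpha>" "z \<noteq> w"
  shows "Re ((fg_H \<alpha> z - fg_H \<alpha> w) / (z - w)) > 0"
proof -
  let ?m = "gamma_distribution 2"
  let ?I = "LINT t|?m. 1 / ((z - complex_of_real t) * (w - complex_of_real t))"
  have aw: "away_from ?m z" "away_from ?m w" using assms by (auto simp: fg_region_def intro: away_from_gamma)
  have "z \<noteq> cnj w" using assms by (auto simp: fg_region_def complex_eq_iff)
  then have "Re ?I < (fg_F z + fg_F w) / 2"
    unfolding fg_F_eq_energy using aw by (intro gamma2.Re_resolvent_product_less) (auto simp: gamma2.emeasure_space_1[simplified])
  also have "\<dots> \<le> 1 / \<alpha>" using assms by (auto simp: fg_region_def)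
  finally have "1 - \<alpha> * Re ?I > 0" using \<alpha> by (simp add: field_simps)
  moreover have "(fg_H \<alpha> z - fg_H \<alpha> w) / (z - w) = 1 - of_real \<alpha> * ?I"
  proof -
    have "fg_H \<alpha> z - fg_H \<alpha> w = (z - w) + of_real \<alpha> * (cauchy_transform ?m z - cauchy_transform ?m w)"
      by (simp add: fg_H_eq algebra_simps)
    also have "\<dots> = (z - w) * (1 - of_real \<alpha> * ?I)"
      unfolding gamma2.cauchy_transform_diff[OF aw] by (simp add: algebra_simps)
    finally show ?thesis using assms(3) by simp
  qed
  ultimately show ?thesis by simp
qed

lemma inj_on_fg_H_region: "inj_on (fg_H \<alpha>) (fg_region \<alpha>)"
  proof (rule inj_onI, rule ccontr)
  fix z w assume "z \<in> fg_region \<alpha>" "w \<in> fg_region \<alpha>" "fg_H \<alpha> z = fg_H \<alpha> w" "z \<noteq> w"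
  then show False using Re_fg_H_difference_quotient_pos[of z w] by simp
qed

text \<open>Low energy also bounds the Cauchy transform, so \<open>H\<close> stays within a bounded distance of the
  identity.  Hence \<open>P\<close> is onto, and \<open>H\<close> is a proper map on the region.\<close>

lemma norm_fg_H_minus_id_le:
  assumes "z \<in> fg_region \<alpha>"
  shows "cmod (fg_H \<alpha> z - z) \<le> \<alpha> + (\<alpha> + 1) / 2"
proof -
  have "away_from (gamma_distribution 2) z" using assms by (auto simp: fg_region_def intro: away_from_gamma)
  from gamma2.norm_cauchy_transform_le[OF this]
  have "cmod (cauchy_transform (gamma_distribution 2) z) \<le> (1 + 1 / \<alpha>) / 2"
    using assms by (simp add: gamma2.prob_space[simplified] fg_region_def fg_F_eq_energy)
  then have "\<alpha> * cmod (cauchy_transform (gamma_distribution 2) z) \<le> \<alpha> * ((1 + 1 / \<alpha>) / 2)"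
    using \<alpha> by (intro mult_left_mono) auto
  also have "\<dots> = (\<alpha> + 1) / 2" using \<alpha> by (simp add: field_simps)
  finally have "cmod (of_real \<alpha> * cauchy_transform (gamma_distribution 2) z) \<le> (\<alpha> + 1) / 2"
    using \<alpha> by (simp only: norm_mult norm_of_real abs_of_pos)
  moreover have "cmod (fg_H \<alpha> z - z) \<le> cmod (of_real \<alpha>) + cmod (of_real \<alpha> * cauchy_transform (gamma_distribution 2) z)"
    using norm_triangle_ineq[of "of_real \<alpha>" "of_real \<alpha> * cauchy_transform (gamma_distribution 2) z"]
    by (simp add: fg_H_eq)
  moreover have "cmod (of_real \<alpha>) = \<alpha>" using \<alpha> by simp
  ultimately show ?thesis by linarith
qed

text \<open>For real \<open>H z\<close> and \<open>H w\<close> the quotient \<open>(H z - H w) / (z - w)\<close> has the sign of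
  \<open>(H z - H w) (Re z - Re w)\<close> as its real part.\<close>

lemma strict_mono_fg_P: "strict_mono (fg_P \<alpha>)"
proof (rule strict_monoI)
  fix x y :: real assume "x < y"
  let ?z = "Complex x (fg_v \<alpha> x)" and ?w = "Complex y (fg_v \<alpha> y)"
  have "Re ((fg_H \<alpha> ?w - fg_H \<alpha> ?z) / (?w - ?z)) > 0"
    using \<open>x < y\<close> by (intro Re_fg_H_difference_quotient_pos fg_curve_in_region) auto
  also have "fg_H \<alpha> ?w - fg_H \<alpha> ?z = of_real (fg_P \<alpha> y - fg_P \<alpha> x)"
    by (simp add: fg_H_curve)
  also have "Re (of_real (fg_P \<alpha> y - fg_P \<alpha> x) / (?w - ?z)) =
      (fg_P \<alpha> y - fg_P \<alpha> x) * ((y - x) / (cmod (?w - ?z))\<^sup>2)"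
    by (simp add: Re_divide cmod_power2)
  finally have "0 < (fg_P \<alpha> y - fg_P \<alpha> x) * ((y - x) / (cmod (?w - ?z))\<^sup>2)" .
  moreover have "(y - x) / (cmod (?w - ?z))\<^sup>2 \<ge> 0" using \<open>x < y\<close> by simp
  ultimately show "fg_P \<alpha> x < fg_P \<alpha> y" by (simp only: zero_less_mult_iff) auto
qed

text \<open>Monotonicity of \<open>F\<close> in \<open>y\<close> turns a bound \<open>v x < b\<close> or \<open>v x > b\<close> into a strict inequality for
  \<open>F (x + i b)\<close>, which persists for nearby \<open>x\<close>.\<close>

lemma isCont_fg_v: "isCont (fg_v \<alpha>) x"
proof -
  have contF: "isCont (\<lambda>x. fg_F (Complex x y)) x" if "y > 0" for x y
    unfolding Complex_eq
    by (rule isCont_o2[where f = "\<lambda>x. of_real x + \<i> * of_real y"])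
       (use that in \<open>auto intro!: continuous_intros isCont_fg_F simp: complex_nonneg_Reals_iff\<close>)
  have upper: "\<forall>\<^sub>F x' in at x. fg_v \<alpha> x' < b" if "fg_v \<alpha> x < b" for b
  proof -
    have b: "b > 0" using that fg_v_nonneg[of x] by linarith
    have "fg_F (Complex x b) < fg_F (Complex x (fg_v \<alpha> x))"
      using that fg_v_nonneg[of x] fg_v_pos[of x] fg_c_pos
      by (intro fg_F_vertical_strict_antimono) (auto simp: not_less)
    then have F: "fg_F (Complex x b) < 1 / \<alpha>"
      using fg_curve_in_region[of x] by (auto simp: fg_region_def)
    have "\<forall>\<^sub>F x' in at x. fg_F (Complex x' b) < 1 / \<alpha>"
      using order_tendstoD(2)[OF contF[OF b, of x, unfolded isCont_def] F] .
    then show ?thesis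
    proof eventually_elim
      case (elim x')
      show ?case
      proof (rule ccontr)
        assume "\<not> fg_v \<alpha> x' < b"
        moreover from this have "x' > - fg_c \<alpha>" using b fg_v_left[of x'] by force
        ultimately show False
          using elim b fg_F_at_v[of x'] fg_F_vertical_strict_antimono[of b "fg_v \<alpha> x'" x']
          by (cases "fg_v \<alpha> x' = b") auto
      qed
    qed
  qed
  have lower: "\<forall>\<^sub>F x' in at x. fg_v \<alpha> x' > b" if "fg_v \<alpha> x > b" for b
  proof (cases "b < 0")
    case True
    then show ?thesis using fg_v_nonneg by (intro always_eventually allI) (meson less_le_trans)
  next
    case False
    define b' where "b' = (b + fg_v \<alpha> x) / 2"
    have b: "b' > 0" "b < b'" "b' < fg_v \<alpha> x" using that False by (auto simp: b'_def)
    then have x: "x > - fg_c \<alpha>" using fg_v_left[of x] by force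
    have "fg_F (Complex x b') > 1 / \<alpha>"
      using fg_F_vertical_strict_antimono[of b' "fg_v \<alpha> x" x] b fg_F_at_v[OF x] by simp
    from order_tendstoD(1)[OF contF[OF b(1), of x, unfolded isCont_def] this]
    have "\<forall>\<^sub>F x' in at x. fg_F (Complex x' b') > 1 / \<alpha>" .
    then show ?thesis
    proof eventually_elim
      case (elim x')
      show ?case
      proof (rule ccontr)
        assume "\<not> fg_v \<alpha> x' > b"
        then have "fg_v \<alpha> x' < b'" using b by simp
        moreover have "fg_v \<alpha> x' > 0 \<or> x' < 0"
          using fg_v_pos[of x'] fg_c_pos by (cases "x' \<le> - fg_c \<alpha>") auto
        ultimately have "fg_F (Complex x' b') < fg_F (Complex x' (fg_v \<alpha> x'))"
          using fg_v_nonneg[of x'] by (intro fg_F_vertical_strict_antimono) auto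
        with elim fg_curve_in_region[of x'] show False by (auto simp: fg_region_def)
      qed
    qed
  qed
  show ?thesis unfolding isCont_def using lower upper by (intro order_tendstoI)
qed

lemma isCont_fg_P: "isCont (fg_P \<alpha>) x"
proof -
  have "isCont (\<lambda>x. fg_H \<alpha> (Complex x (fg_v \<alpha> x))) x"
    by (rule isCont_o2[of x "\<lambda>x. Complex x (fg_v \<alpha> x)"])
       (use fg_curve_in_region[of x] in \<open>auto intro!: continuous_intros isCont_fg_H isCont_fg_v
           simp: Complex_eq fg_region_def\<close>)
  then show ?thesis by (simp add: fg_P_def[abs_def] isCont_Re)
qed

lemma abs_fg_P_minus_id_le: "\<bar>fg_P \<alpha> x - x\<bar> \<le> \<alpha> + (\<alpha> + 1) / 2"
proof -
  have "\<bar>fg_P \<alpha> x - x\<bar> = \<bar>Re (fg_H \<alpha> (Complex x (fg_v \<alpha> x)) - Complex x (fg_v \<alpha> x))\<bar>"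
    by (simp add: fg_P_def)
  also have "\<dots> \<le> cmod (fg_H \<alpha> (Complex x (fg_v \<alpha> x)) - Complex x (fg_v \<alpha> x))"
    by (rule abs_Re_le_cmod)
  also have "\<dots> \<le> \<alpha> + (\<alpha> + 1) / 2" by (rule norm_fg_H_minus_id_le[OF fg_curve_in_region])
  finally show ?thesis .
qed

lemma bij_fg_P: "bij (fg_P \<alpha>)"
proof (rule bijI)
  show "inj (fg_P \<alpha>)" using strict_mono_fg_P by (rule strict_mono_imp_inj_on)
  show "surj (fg_P \<alpha>)"
  unfolding surj_def
  proof
    fix \<xi> :: real
    let ?K = "\<alpha> + (\<alpha> + 1) / 2"
    have "fg_P \<alpha> (\<xi> - ?K) \<le> \<xi>" "fg_P \<alpha> (\<xi> + ?K) \<ge> \<xi>"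
      using abs_fg_P_minus_id_le[of "\<xi> - ?K"] abs_fg_P_minus_id_le[of "\<xi> + ?K"] by linarith+
    then have "\<exists>x\<ge>\<xi> - ?K. x \<le> \<xi> + ?K \<and> fg_P \<alpha> x = \<xi>"
      using isCont_fg_P \<alpha> by (intro IVT) auto
    then show "\<exists>x. \<xi> = fg_P \<alpha> x" by blast
  qed
qed

end

section \<open>Strict unimodality of the density\<close>

text \<open>Such an \<open>f\<close> is strictly quasi-concave.  If \<open>f y\<close> were at most \<open>f x\<close> and at most \<open>f z\<close> for some
  \<open>x < y < z\<close>, then the level \<open>f y\<close> would be attained once up to \<open>x\<close>, as \<open>f\<close> rises there from \<open>0\<close>,
  once at \<open>y\<close>, and once from \<open>z\<close> on, as \<open>f\<close> decays there to \<open>0\<close>.\<close>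

lemma strictly_unimodal_if_levels_attained_at_most_twice:
  fixes f :: "real \<Rightarrow> real"
  assumes cont: "continuous_on {a..} f" and fa: "f a = 0" and pos: "\<And>x. x > a \<Longrightarrow> f x > 0"
    and lim: "(f \<longlongrightarrow> 0) at_top"
    and twice: "\<And>x y z. a < x \<Longrightarrow> x < y \<Longrightarrow> y < z \<Longrightarrow> f x = f y \<Longrightarrow> f y = f z \<Longrightarrow> False"
  shows "\<exists>m>a. strict_mono_on {a..m} f \<and> strict_antimono_on {m..} f"
proof -
  have small: "\<exists>b>c. f b < e" if "e > 0" for e c
  proof -
    have "\<forall>\<^sub>F x in at_top. f x < e" using order_tendstoD(2)[OF lim that] .
    then have "\<forall>\<^sub>F x in at_top. f x < e \<and> x > c"
      using eventually_gt_at_top[of c] by eventually_elim auto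
    then show ?thesis using eventually_happens' trivial_limit_at_top_linorder by blast
  qed
  have quasiconcave: "f y > min (f x) (f z)" if "a \<le> x" "x < y" "y < z" for x y z
  proof (rule ccontr)
    assume "\<not> f y > min (f x) (f z)"
    then have le: "f y \<le> f x" "f y \<le> f z" by auto
    have fy: "f y > 0" using pos that by auto
    have "\<exists>x'\<ge>a. x' \<le> x \<and> f x' = f y"
      using le fa fy that by (intro IVT' continuous_on_subset[OF cont]) auto
    then obtain x' where x': "a \<le> x'" "x' \<le> x" "f x' = f y" by blast
    have "a \<noteq> x'" using x' fa fy by auto
    obtain b where b: "b > z" "f b < f y" using small[OF fy] by blast
    have "\<exists>z'\<ge>z. z' \<le> b \<and> f z' = f y"
      using le b that by (intro IVT2' continuous_on_subset[OF cont]) auto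
    then obtain z' where z': "z \<le> z'" "f z' = f y" by blast
    show False
      by (rule twice[of x' y z']) (use x' z' \<open>a \<noteq> x'\<close> that in auto)
  qed
  obtain b where b: "b > a + 1" "\<And>x. x \<ge> b \<Longrightarrow> f x < f (a + 1)"
  proof -
    have "\<forall>\<^sub>F x in at_top. f x < f (a + 1)" using order_tendstoD(2)[OF lim, of "f (a + 1)"] pos[of "a + 1"] by simp
    then obtain N where N: "\<And>x. x \<ge> N \<Longrightarrow> f x < f (a + 1)" unfolding eventually_at_top_linorder by blast
    show ?thesis by (rule that[of "max N (a + 2)"]) (use N in auto)
  qed
  have "\<exists>m\<in>{a..b}. \<forall>y\<in>{a..b}. f y \<le> f m"
    using b(1) by (intro continuous_attains_sup continuous_on_subset[OF cont]) auto
  then obtain m where m: "a \<le> m" "m \<le> b" "\<And>y. a \<le> y \<Longrightarrow> y \<le> b \<Longrightarrow> f y \<le> f m" by auto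
  have max: "f y \<le> f m" if "y \<ge> a" for y
    using m(3)[of y] m(3)[of "a + 1"] b(1) b(2)[of y] that by (cases "y \<le> b") auto
  have "m \<noteq> a" using max[of "a + 1"] pos[of "a + 1"] fa by auto
  with m(1) have "m > a" by simp
  have strict: "f y < f m" if "y \<ge> a" "y \<noteq> m" for y
  proof (rule ccontr)
    assume "\<not> f y < f m"
    with max[OF that(1)] have eq: "f y = f m" by simp
    let ?w = "(y + m) / 2"
    \<comment> \<open>A second maximum would be surpassed strictly between the two.\<close>
    have "f ?w > f m"
      using that eq m(1) quasiconcave[of y ?w m] quasiconcave[of m ?w y] by (cases "y < m") auto
    with max[of ?w] that m(1) show False by auto
  qed
  have "strict_mono_on {a..m} f"
  proof (rule strict_mono_onI)
    fix x y assume xy: "x \<in> {a..m}" "y \<in> {a..m}" "x < y"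
    show "f x < f y"
    proof (cases "y = m")
      case False
      then have "f y > min (f x) (f m)" using xy by (intro quasiconcave) auto
      then show ?thesis using max[of y] xy by auto
    qed (use xy strict in auto)
  qed
  moreover have "strict_antimono_on {m..} f"
  proof (rule monotone_onI)
    fix x y assume xy: "x \<in> {m..}" "y \<in> {m..}" "x < y"
    show "f x > f y"
    proof (cases "x = m")
      case False
      then have "f x > min (f m) (f y)" using xy m by (intro quasiconcave) auto
      then show ?thesis using max[of x] xy m by auto
    qed (use xy m strict in auto)
  qed
  ultimately show ?thesis using \<open>m > a\<close> by blast
qed

text \<open>The function \<open>(p, D) \<mapsto> exp (- p) / D = exp (- p - ln D)\<close> is jointly convex, and the left-hand side
  is its tangent at \<open>(q, E)\<close>.  Both \<open>exp\<close> and \<open>ln\<close> are replaced by their tangents; the second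
  replacement is strict because \<open>D \<noteq> E\<close>.\<close>

lemma exp_over_tangent_less:
  fixes p q D E :: real
  assumes "D > 0" "E > 0" "D \<noteq> E"
  shows "exp (- q) / E * (2 - (p - q) - D / E) < exp (- p) / D"
proof -
  have "ln (D / E) < D / E - 1"
    using assms ln_le_minus_one[of "D / E"] ln_eq_minus_one[of "D / E"] by (force simp: less_le)
  then have "2 - (p - q) - D / E < 1 + (- (p - q) - ln (D / E))" by simp
  also have "\<dots> \<le> exp (- (p - q) - ln (D / E))" by (rule exp_ge_add_one_self)
  also have "\<dots> = exp (- p) * exp q * E / D"
    using assms by (simp add: exp_diff exp_add[symmetric])
  finally have "exp (- q) / E * (2 - (p - q) - D / E) < exp (- q) / E * (exp (- p) * exp q * E / D)"
    using assms by (intro mult_strict_left_mono) auto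
  also have "\<dots> = exp (- p) / D" using assms by (simp add: exp_minus)
  finally show ?thesis .
qed

text \<open>The integrand of \<open>F\<close> at the point with argument \<open>arccos \<kappa>\<close> on the circle of diameter \<open>R\<close> that
  touches the real axis at the origin from above, after scaling \<open>t\<close> by the modulus of that point.\<close>

definition circle_integrand :: "real \<Rightarrow> real \<Rightarrow> real \<Rightarrow> real" where
  "circle_integrand R \<kappa> s = indicator {0..} s * (s * exp (- (R * sqrt (1 - \<kappa>\<^sup>2) * s)) / (1 - 2 * \<kappa> * s + s\<^sup>2))"

lemma circle_denominator_pos:
  assumes "\<bar>\<kappa>\<bar> < (1::real)"
  shows "1 - 2 * \<kappa> * s + s\<^sup>2 > 0"
proof -
  have "\<kappa>\<^sup>2 < 1" using assms by (simp add: abs_square_less_1)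
  moreover have "1 - 2 * \<kappa> * s + s\<^sup>2 = (s - \<kappa>)\<^sup>2 + (1 - \<kappa>\<^sup>2)" by (simp add: power2_eq_square algebra_simps)
  ultimately show ?thesis using zero_le_power2[of "s - \<kappa>"] by linarith
qed

text \<open>Summing the tangent bounds at \<open>a \<kappa>1 + b \<kappa>2\<close> with the weights \<open>a\<close> and \<open>b\<close>, the terms from the
  denominator cancel because it is affine in \<open>\<kappa>\<close>, and those from the exponent have the right sign
  because \<open>sqrt (1 - \<kappa>\<^sup>2)\<close> is concave.\<close>

lemma circle_integrand_strictly_convex:
  assumes "\<bar>\<kappa>1\<bar> < 1" "\<bar>\<kappa>2\<bar> < 1" "\<kappa>1 \<noteq> \<kappa>2" "a > 0" "b > 0" "a + b = 1" "R > 0" "s > 0"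
  shows "circle_integrand R (a * \<kappa>1 + b * \<kappa>2) s < a * circle_integrand R \<kappa>1 s + b * circle_integrand R \<kappa>2 s"
proof -
  define \<kappa> where "\<kappa> = a * \<kappa>1 + b * \<kappa>2"
  define q where "q x = sqrt (1 - x\<^sup>2)" for x :: real
  define D where "D x = 1 - 2 * x * s + s\<^sup>2" for x
  have b: "b = 1 - a" using assms by simp
  have "\<bar>\<kappa>\<bar> \<le> a * \<bar>\<kappa>1\<bar> + b * \<bar>\<kappa>2\<bar>"
    using abs_triangle_ineq[of "a * \<kappa>1" "b * \<kappa>2"] assms(4,5) by (simp add: \<kappa>_def abs_mult)
  also have "\<dots> < a * 1 + b * 1" using assms by (intro add_strict_mono mult_strict_left_mono) auto
  finally have \<kappa>: "\<bar>\<kappa>\<bar> < 1" using assms(6) by simp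
  have q2: "(q x)\<^sup>2 = 1 - x\<^sup>2" if "\<bar>x\<bar> < 1" for x
    using that abs_square_less_1[of x] by (simp add: q_def)
  \<comment> \<open>The points \<open>(\<kappa>, q \<kappa>)\<close> lie on the unit circle, and chords stay inside the disc.\<close>
  have concave: "a * q \<kappa>1 + b * q \<kappa>2 \<le> q \<kappa>"
    unfolding q_def[of \<kappa>]
  proof (rule real_le_rsqrt)
    have "2 * (\<kappa>1 * \<kappa>2 + q \<kappa>1 * q \<kappa>2) \<le> \<kappa>1\<^sup>2 + (q \<kappa>1)\<^sup>2 + (\<kappa>2\<^sup>2 + (q \<kappa>2)\<^sup>2)"
      using zero_le_power2[of "\<kappa>1 - \<kappa>2"] zero_le_power2[of "q \<kappa>1 - q \<kappa>2"]
      by (simp add: power2_eq_square algebra_simps)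
    then have "\<kappa>1 * \<kappa>2 + q \<kappa>1 * q \<kappa>2 \<le> 1" using assms(1,2) by (simp add: q2)
    then have "2 * a * b * (\<kappa>1 * \<kappa>2 + q \<kappa>1 * q \<kappa>2) \<le> 2 * a * b * 1"
      using assms by (intro mult_left_mono) auto
    moreover have "(a * q \<kappa>1 + b * q \<kappa>2)\<^sup>2 + \<kappa>\<^sup>2 =
        a\<^sup>2 * ((q \<kappa>1)\<^sup>2 + \<kappa>1\<^sup>2) + b\<^sup>2 * ((q \<kappa>2)\<^sup>2 + \<kappa>2\<^sup>2) + 2 * a * b * (\<kappa>1 * \<kappa>2 + q \<kappa>1 * q \<kappa>2)"
      by (simp add: \<kappa>_def power2_eq_square algebra_simps)
    moreover have "a\<^sup>2 + b\<^sup>2 + 2 * a * b = 1" by (simp add: b power2_eq_square algebra_simps)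
    ultimately show "(a * q \<kappa>1 + b * q \<kappa>2)\<^sup>2 \<le> 1 - \<kappa>\<^sup>2" using assms(1,2) by (simp add: q2)
  qed
  have Dpos: "D \<kappa> > 0" "D \<kappa>1 > 0" "D \<kappa>2 > 0"
    using circle_denominator_pos \<kappa> assms by (auto simp: D_def)
  have "\<kappa> - \<kappa>1 = b * (\<kappa>2 - \<kappa>1)" "\<kappa> - \<kappa>2 = a * (\<kappa>1 - \<kappa>2)" by (simp_all add: \<kappa>_def b algebra_simps)
  then have "\<kappa>1 \<noteq> \<kappa>" "\<kappa>2 \<noteq> \<kappa>" using assms by auto
  then have Dne: "D \<kappa>1 \<noteq> D \<kappa>" "D \<kappa>2 \<noteq> D \<kappa>" using assms(8) by (auto simp: D_def)
  define g where "g x = exp (- (R * q x * s)) / D x" for x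
  define T where "T x = g \<kappa> * (2 - (R * q x * s - R * q \<kappa> * s) - D x / D \<kappa>)" for x
  \<comment> \<open>\<open>T\<close> is the tangent bound based at the intermediate point \<open>\<kappa>\<close>.\<close>
  have T: "T \<kappa>1 < g \<kappa>1" "T \<kappa>2 < g \<kappa>2"
    unfolding T_def g_def by (rule exp_over_tangent_less; use Dpos Dne in simp)+
  have "a * D \<kappa>1 + b * D \<kappa>2 = D \<kappa>" by (simp add: D_def \<kappa>_def b algebra_simps)
  then have DD: "a * (D \<kappa>1 / D \<kappa>) + b * (D \<kappa>2 / D \<kappa>) = 1"
    using Dpos by (simp add: field_simps)
  have "a * T \<kappa>1 + b * T \<kappa>2 =
      g \<kappa> * (2 * (a + b) - R * s * (a * q \<kappa>1 + b * q \<kappa>2) + R * s * (a + b) * q \<kappa> -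
        (a * (D \<kappa>1 / D \<kappa>) + b * (D \<kappa>2 / D \<kappa>)))"
    unfolding T_def by (simp add: algebra_simps)
  also have "\<dots> = g \<kappa> * (1 + R * s * (q \<kappa> - (a * q \<kappa>1 + b * q \<kappa>2)))"
    unfolding DD assms(6) by (simp add: algebra_simps)
  also have "\<dots> \<ge> g \<kappa> * 1"
    using concave assms Dpos by (intro mult_left_mono) (auto simp: g_def intro!: mult_nonneg_nonneg)
  finally have "g \<kappa> \<le> a * T \<kappa>1 + b * T \<kappa>2" by simp
  also have "\<dots> < a * g \<kappa>1 + b * g \<kappa>2"
    using T assms by (intro add_strict_mono mult_strict_left_mono) auto
  finally have "s * g \<kappa> < s * (a * g \<kappa>1 + b * g \<kappa>2)" using assms(8) by simp
  then show ?thesis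
    unfolding \<kappa>_def[symmetric] using assms(8)
    by (simp add: circle_integrand_def g_def q_def D_def algebra_simps)
qed

text \<open>The substitution \<open>t = r s\<close>, with \<open>r\<close> the modulus of the point.\<close>

lemma fg_F_polar:
  assumes "\<bar>\<kappa>\<bar> < 1" "R > 0"
  defines "r \<equiv> R * sqrt (1 - \<kappa>\<^sup>2)"
  shows "integrable lborel (circle_integrand R \<kappa>)"
    and "fg_F (Complex (r * \<kappa>) (r * sqrt (1 - \<kappa>\<^sup>2))) = (LINT s|lborel. circle_integrand R \<kappa> s)"
proof -
  let ?z = "Complex (r * \<kappa>) (r * sqrt (1 - \<kappa>\<^sup>2))"
  have k: "1 - \<kappa>\<^sup>2 > 0" using assms by (simp add: abs_square_less_1)
  then have r: "r > 0" using assms by simp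
  have z: "?z \<notin> \<real>\<^sub>\<ge>\<^sub>0" using r k by (simp add: complex_nonneg_Reals_iff)
  have eq: "r * (gamma_density 2 (0 + r * s) *\<^sub>R (1 / (cmod (?z - complex_of_real (0 + r * s)))\<^sup>2)) = circle_integrand R \<kappa> s" for s
  proof -
    have "(cmod (?z - complex_of_real (0 + r * s)))\<^sup>2 = (r * \<kappa> - r * s)\<^sup>2 + (r * sqrt (1 - \<kappa>\<^sup>2))\<^sup>2"
      by (simp add: cmod_power2)
    also have "\<dots> = r\<^sup>2 * ((\<kappa> - s)\<^sup>2 + (1 - \<kappa>\<^sup>2))"
      using k by (simp add: power_mult_distrib) (simp add: power2_eq_square algebra_simps)
    also have "\<dots> = r\<^sup>2 * (1 - 2 * \<kappa> * s + s\<^sup>2)" by (simp add: power2_eq_square algebra_simps)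
    finally have "(cmod (?z - complex_of_real (0 + r * s)))\<^sup>2 = r\<^sup>2 * (1 - 2 * \<kappa> * s + s\<^sup>2)" .
    moreover have "0 \<le> r * s \<longleftrightarrow> 0 \<le> s" using r by (simp add: zero_le_mult_iff)
    ultimately show ?thesis
      using r circle_denominator_pos[OF assms(1), of s]
      by (simp add: gamma_density_2 circle_integrand_def indicator_def r_def[symmetric]) (simp add: power2_eq_square)
  qed
  have i: "integrable lborel (\<lambda>t. gamma_density 2 t *\<^sub>R (1 / (cmod (?z - complex_of_real t))\<^sup>2))"
    using gamma2.integrable_energy[OF away_from_gamma[OF z]] by (subst (asm) integrable_gamma_distribution) auto
  have "integrable lborel (\<lambda>s. gamma_density 2 (0 + r * s) *\<^sub>R (1 / (cmod (?z - complex_of_real (0 + r * s)))\<^sup>2))"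
    using i r by (intro lborel_integrable_real_affine) auto
  then have "integrable lborel (\<lambda>s. r * (gamma_density 2 (0 + r * s) *\<^sub>R (1 / (cmod (?z - complex_of_real (0 + r * s)))\<^sup>2)))"
    by (rule integrable_mult_right)
  then show "integrable lborel (circle_integrand R \<kappa>)" unfolding eq .
  have "fg_F ?z = (LINT t|lborel. gamma_density 2 t *\<^sub>R (1 / (cmod (?z - complex_of_real t))\<^sup>2))"
    by (simp add: fg_F_eq_energy cauchy_energy_def integral_gamma_distribution)
  also have "\<dots> = \<bar>r\<bar> *\<^sub>R (LINT s|lborel. gamma_density 2 (0 + r * s) *\<^sub>R (1 / (cmod (?z - complex_of_real (0 + r * s)))\<^sup>2))"
    using r by (intro lborel_integral_real_affine) auto
  also have "\<dots> = (LINT s|lborel. r * (gamma_density 2 (0 + r * s) *\<^sub>R (1 / (cmod (?z - complex_of_real (0 + r * s)))\<^sup>2)))"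
    using r by (simp only: real_scaleR_def abs_of_pos integral_mult_right_zero)
  finally show "fg_F ?z = (LINT s|lborel. circle_integrand R \<kappa> s)" unfolding eq .
qed

lemma circle_integral_strictly_convex:
  assumes "\<bar>\<kappa>1\<bar> < 1" "\<bar>\<kappa>2\<bar> < 1" "\<kappa>1 \<noteq> \<kappa>2" "a > 0" "b > 0" "a + b = 1" "R > 0"
  shows "(LINT s|lborel. circle_integrand R (a * \<kappa>1 + b * \<kappa>2) s) <
    a * (LINT s|lborel. circle_integrand R \<kappa>1 s) + b * (LINT s|lborel. circle_integrand R \<kappa>2 s)"
proof -
  let ?g = "circle_integrand R" and ?k = "a * \<kappa>1 + b * \<kappa>2"
  define h where "h s = a * ?g \<kappa>1 s + b * ?g \<kappa>2 s - ?g ?k s" for s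
  have "\<bar>?k\<bar> \<le> a * \<bar>\<kappa>1\<bar> + b * \<bar>\<kappa>2\<bar>"
    using abs_triangle_ineq[of "a * \<kappa>1" "b * \<kappa>2"] assms(4,5) by (simp add: abs_mult)
  also have "\<dots> < a * 1 + b * 1" using assms by (intro add_strict_mono mult_strict_left_mono) auto
  finally have k: "\<bar>?k\<bar> < 1" using assms(6) by simp
  have ints: "integrable lborel (?g \<kappa>1)" "integrable lborel (?g \<kappa>2)" "integrable lborel (?g ?k)"
    using fg_F_polar(1) assms k by auto
  have hpos: "h s > 0" if "s > 0" for s
    using circle_integrand_strictly_convex[OF assms that] by (simp add: h_def)
  have hnn: "h s \<ge> 0" for s
    using hpos[of s] by (cases "s > 0") (auto simp: h_def circle_integrand_def indicator_def)
  have hi: "integrable lborel h" unfolding h_def[abs_def] using ints by auto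
  have "(LINT s|lborel. h s) \<noteq> 0"
  proof
    assume "(LINT s|lborel. h s) = 0"
    then have "AE s in lborel. h s = 0"
      using integral_nonneg_eq_0_iff_AE[OF hi] hnn by auto
    then have "AE s in lborel. s \<notin> {0<..<(1::real)}"
      by eventually_elim (use hpos in force)
    then have "emeasure lborel {s. \<not> s \<notin> {0<..<(1::real)}} = 0"
      by (subst (asm) AE_iff_measurable[OF _ refl]) auto
    also have "{s. \<not> s \<notin> {0<..<(1::real)}} = {0<..<1}" by auto
    finally show False by simp
  qed
  moreover have "(LINT s|lborel. h s) \<ge> 0" using hnn by (intro integral_nonneg_AE) auto
  moreover have "(LINT s|lborel. h s) = a * (LINT s|lborel. ?g \<kappa>1 s) + b * (LINT s|lborel. ?g \<kappa>2 s) - (LINT s|lborel. ?g ?k s)"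
    unfolding h_def using ints by simp
  ultimately show ?thesis by linarith
qed

lemma circle_integral_less_between:
  assumes "\<bar>\<kappa>1\<bar> < 1" "\<bar>\<kappa>3\<bar> < 1" "\<kappa>1 < \<kappa>2" "\<kappa>2 < \<kappa>3" "R > 0"
    and "(LINT s|lborel. circle_integrand R \<kappa>1 s) = L" "(LINT s|lborel. circle_integrand R \<kappa>3 s) = L"
  shows "(LINT s|lborel. circle_integrand R \<kappa>2 s) < L"
proof -
  define a where "a = (\<kappa>3 - \<kappa>2) / (\<kappa>3 - \<kappa>1)"
  define b where "b = (\<kappa>2 - \<kappa>1) / (\<kappa>3 - \<kappa>1)"
  have ab: "a > 0" "b > 0" using assms by (auto simp: a_def b_def)
  have ab1: "a + b = 1" using assms by (simp add: a_def b_def add_divide_distrib[symmetric])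
  have "a * \<kappa>1 + b * \<kappa>3 = ((\<kappa>3 - \<kappa>2) * \<kappa>1 + (\<kappa>2 - \<kappa>1) * \<kappa>3) / (\<kappa>3 - \<kappa>1)"
    by (simp add: a_def b_def add_divide_distrib)
  also have "(\<kappa>3 - \<kappa>2) * \<kappa>1 + (\<kappa>2 - \<kappa>1) * \<kappa>3 = \<kappa>2 * (\<kappa>3 - \<kappa>1)" by (simp add: algebra_simps)
  finally have k2: "a * \<kappa>1 + b * \<kappa>3 = \<kappa>2" using assms by simp
  have "(LINT s|lborel. circle_integrand R \<kappa>2 s) < a * L + b * L"
    using circle_integral_strictly_convex[OF assms(1,2) _ ab ab1 assms(5)] assms by (simp add: k2)
  also have "\<dots> = L" using ab1 by (simp add: distrib_right[symmetric])
  finally show ?thesis .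
qed

context
  fixes \<alpha> :: real
  assumes \<alpha>: "\<alpha> > 0"
begin

text \<open>A point of the curve on which \<open>Q\<close> takes the value \<open>\<rho>\<close> lies on the circle of diameter \<open>1 / \<rho>\<close>, and
  its abscissa can be recovered from \<open>\<kappa>\<close>; so different such points have different \<open>\<kappa>\<close>.\<close>

lemma fg_Q_level_point:
  assumes "x > - fg_c \<alpha>" "fg_Q \<alpha> x = \<rho>"
  defines "\<kappa> \<equiv> x / cmod (Complex x (fg_v \<alpha> x))"
  shows "\<bar>\<kappa>\<bar> < 1" "\<rho> > 0" "x = (1 / \<rho>) * sqrt (1 - \<kappa>\<^sup>2) * \<kappa>"
    "(LINT s|lborel. circle_integrand (1 / \<rho>) \<kappa> s) = 1 / \<alpha>"
proof -
  define y where "y = fg_v \<alpha> x"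
  define r where "r = cmod (Complex x y)"
  have y: "y > 0" using fg_v_pos[OF \<alpha> assms(1)] by (simp add: y_def)
  have r2: "r\<^sup>2 = x\<^sup>2 + y\<^sup>2" by (simp add: r_def cmod_power2)
  have r: "r > 0" using y by (simp add: r_def complex_eq_iff)
  have \<rho>: "\<rho> = y / r\<^sup>2" using assms(2) by (simp add: fg_Q_def r2 y_def)
  show \<rho>pos: "\<rho> > 0" using y r by (simp add: \<rho>)
  have \<kappa>: "\<kappa> = x / r" by (simp add: \<kappa>_def r_def y_def)
  have "\<kappa>\<^sup>2 = x\<^sup>2 / r\<^sup>2" by (simp add: \<kappa> power_divide)
  moreover have "x\<^sup>2 / r\<^sup>2 + y\<^sup>2 / r\<^sup>2 = 1" using r by (simp add: r2[symmetric] add_divide_distrib[symmetric])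
  ultimately have "1 - \<kappa>\<^sup>2 = (y / r)\<^sup>2" by (simp add: power_divide)
  then have sq: "sqrt (1 - \<kappa>\<^sup>2) = y / r" and "1 - \<kappa>\<^sup>2 > 0" using y r by simp_all
  then have lt: "\<kappa>\<^sup>2 < 1" by simp
  show \<kappa>1: "\<bar>\<kappa>\<bar> < 1" using lt by (simp add: abs_square_less_1)
  have rr: "(1 / \<rho>) * sqrt (1 - \<kappa>\<^sup>2) = r" unfolding \<rho> sq using y r by (simp add: power2_eq_square)
  show "x = (1 / \<rho>) * sqrt (1 - \<kappa>\<^sup>2) * \<kappa>" unfolding rr using r by (simp add: \<kappa>)
  have "(LINT s|lborel. circle_integrand (1 / \<rho>) \<kappa> s) = fg_F (Complex (r * \<kappa>) (r * sqrt (1 - \<kappa>\<^sup>2)))"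
    using fg_F_polar(2)[OF \<kappa>1, of "1 / \<rho>"] \<rho>pos unfolding rr by simp
  also have "Complex (r * \<kappa>) (r * sqrt (1 - \<kappa>\<^sup>2)) = Complex x y" unfolding sq using r by (simp add: \<kappa>)
  also have "fg_F (Complex x y) = 1 / \<alpha>" using fg_F_at_v[OF \<alpha> assms(1)] by (simp add: y_def)
  finally show "(LINT s|lborel. circle_integrand (1 / \<rho>) \<kappa> s) = 1 / \<alpha>" .
qed

lemma fg_Q_level_at_most_twice:
  assumes "- fg_c \<alpha> < x" "x < y" "y < z" "fg_Q \<alpha> x = fg_Q \<alpha> y" "fg_Q \<alpha> y = fg_Q \<alpha> z"
  shows False
proof -
  define \<rho> where "\<rho> = fg_Q \<alpha> y"
  define k where "k u = u / cmod (Complex u (fg_v \<alpha> u))" for u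
  have lev: "\<bar>k u\<bar> < 1" "\<rho> > 0" "u = (1 / \<rho>) * sqrt (1 - (k u)\<^sup>2) * k u"
    "(LINT s|lborel. circle_integrand (1 / \<rho>) (k u) s) = 1 / \<alpha>" if "u \<in> {x, y, z}" for u
    using fg_Q_level_point[of u \<rho>] that assms by (auto simp: \<rho>_def k_def)
  \<comment> \<open>Strict convexity excludes a middle value equal to both outer ones, whatever the order in
    which the three values of \<open>k\<close> come.\<close>
  have between: False if "u \<in> {x, y, z}" "v \<in> {x, y, z}" "w \<in> {x, y, z}" "k u < k v" "k v < k w" for u v w
    using circle_integral_less_between[OF lev(1)[OF that(1)] lev(1)[OF that(3)] that(4,5) _
        lev(4)[OF that(1)] lev(4)[OF that(3)]] lev(2)[OF that(1)] lev(4)[OF that(2)]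
    by simp
  have inj: "u = v" if "u \<in> {x, y, z}" "v \<in> {x, y, z}" "k u = k v" for u v
    using lev(3)[OF that(1)] lev(3)[OF that(2)] that(3) by simp
  have "k x \<noteq> k y" "k y \<noteq> k z" "k x \<noteq> k z"
    using inj[of x y] inj[of y z] inj[of x z] assms(2,3) by force+
  then show False
    using between[of x y z] between[of x z y] between[of y x z] between[of y z x] between[of z x y] between[of z y x]
    by (simp add: neq_iff) blast
qed

lemma fg_Q_pos: "x > - fg_c \<alpha> \<Longrightarrow> fg_Q \<alpha> x > 0"
  using fg_v_pos[OF \<alpha>, of x] by (auto simp: fg_Q_def intro!: divide_pos_pos add_nonneg_pos)

lemma fg_Q_left: "x \<le> - fg_c \<alpha> \<Longrightarrow> fg_Q \<alpha> x = 0"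
  using fg_v_left[OF \<alpha>, of x] by (simp add: fg_Q_def)

text \<open>The denominator cannot vanish: at \<open>x = 0\<close>, which lies to the right of \<open>- c\<close>, \<open>v\<close> is positive.\<close>

lemma isCont_fg_Q: "isCont (fg_Q \<alpha>) x"
proof -
  have "x\<^sup>2 + (fg_v \<alpha> x)\<^sup>2 \<noteq> 0"
    using fg_v_pos[OF \<alpha>, of 0] fg_c_pos[OF \<alpha>] by (auto simp: sum_power2_eq_zero_iff)
  then show ?thesis
    unfolding fg_Q_def[abs_def] by (intro continuous_intros isCont_fg_v[OF \<alpha>]) auto
qed

lemma fg_Q_tendsto_0: "(fg_Q \<alpha> \<longlongrightarrow> 0) at_top"
proof (rule tendsto_sandwich[of "\<lambda>_. 0" _ _ "\<lambda>x. 1 / x"])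
  show "\<forall>\<^sub>F x in at_top. 0 \<le> fg_Q \<alpha> x"
    using fg_v_nonneg[OF \<alpha>] by (intro always_eventually) (simp add: fg_Q_def)
  show "\<forall>\<^sub>F x in at_top. fg_Q \<alpha> x \<le> 1 / x"
    using eventually_gt_at_top[of 0]
  proof eventually_elim
    case (elim x)
    have "2 * (fg_v \<alpha> x * x) \<le> x\<^sup>2 + (fg_v \<alpha> x)\<^sup>2"
      using zero_le_power2[of "fg_v \<alpha> x - x"] by (simp add: power2_eq_square algebra_simps)
    moreover have "fg_v \<alpha> x * x \<ge> 0" using fg_v_nonneg[OF \<alpha>, of x] elim by simp
    ultimately have "fg_v \<alpha> x * x \<le> x\<^sup>2 + (fg_v \<alpha> x)\<^sup>2" by linarith
    moreover have "x\<^sup>2 + (fg_v \<alpha> x)\<^sup>2 > 0" using elim by (intro add_pos_nonneg) auto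
    ultimately show ?case using elim by (simp add: fg_Q_def divide_simps)
  qed
qed (use tendsto_inverse_0_at_top[OF filterlim_ident] in \<open>auto simp: inverse_eq_divide\<close>)

lemma fg_Q_strictly_unimodal:
  "\<exists>m>- fg_c \<alpha>. strict_mono_on {- fg_c \<alpha>..m} (fg_Q \<alpha>) \<and> strict_antimono_on {m..} (fg_Q \<alpha>)"
proof (rule strictly_unimodal_if_levels_attained_at_most_twice)
  show "continuous_on {- fg_c \<alpha>..} (fg_Q \<alpha>)"
    by (intro continuous_at_imp_continuous_on ballI isCont_fg_Q)
qed (use fg_Q_level_at_most_twice fg_Q_left fg_Q_pos fg_Q_tendsto_0 in blast)+

text \<open>The formula for \<open>\<xi> > s\<close> is valid everywhere, since \<open>Q\<close> vanishes up to \<open>- c\<close>.\<close>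

lemma free_gamma_density_eq: "free_gamma_density \<alpha> \<xi> = fg_Q \<alpha> (inv (fg_P \<alpha>) \<xi>) / pi"
proof (cases "\<xi> \<le> fg_s \<alpha>")
  case True
  have "fg_P \<alpha> (inv (fg_P \<alpha>) \<xi>) = \<xi>" using bij_fg_P[OF \<alpha>] by (simp add: bij_is_surj surj_f_inv_f)
  with True have "inv (fg_P \<alpha>) \<xi> \<le> - fg_c \<alpha>"
    by (metis fg_s_def strict_mono_fg_P[OF \<alpha>] strict_mono_less_eq)
  with True show ?thesis by (simp add: free_gamma_density_def fg_Q_left)
qed (simp add: free_gamma_density_def)

lemma inv_fg_P_strict_mono: "\<xi> < \<zeta> \<Longrightarrow> inv (fg_P \<alpha>) \<xi> < inv (fg_P \<alpha>) \<zeta>"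
  by (metis bij_fg_P[OF \<alpha>] bij_inv_eq_iff strict_mono_fg_P[OF \<alpha>] strict_mono_less)

lemma inv_fg_P_fg_P: "inv (fg_P \<alpha>) (fg_P \<alpha> x) = x"
  using bij_fg_P[OF \<alpha>] by (simp add: bij_is_inj inv_f_f)

lemma free_gamma_density_strictly_unimodal:
  "\<exists>\<omega>>fg_s \<alpha>. strict_mono_on {fg_s \<alpha>..\<omega>} (free_gamma_density \<alpha>) \<and>
     strict_antimono_on {\<omega>..} (free_gamma_density \<alpha>)"
proof -
  obtain m where m: "m > - fg_c \<alpha>" "strict_mono_on {- fg_c \<alpha>..m} (fg_Q \<alpha>)" "strict_antimono_on {m..} (fg_Q \<alpha>)"
    using fg_Q_strictly_unimodal by blast
  have mono: "inv (fg_P \<alpha>) \<xi> \<le> inv (fg_P \<alpha>) \<zeta>" if "\<xi> \<le> \<zeta>" for \<xi> \<zeta>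
    using inv_fg_P_strict_mono[of \<xi> \<zeta>] that by (cases "\<xi> = \<zeta>") auto
  have s: "inv (fg_P \<alpha>) (fg_s \<alpha>) = - fg_c \<alpha>" by (simp add: fg_s_def inv_fg_P_fg_P)
  show ?thesis
  proof (intro exI[of _ "fg_P \<alpha> m"] conjI)
    show "fg_P \<alpha> m > fg_s \<alpha>"
      unfolding fg_s_def using m(1) strict_mono_fg_P[OF \<alpha>] by (simp add: strict_mono_less)
    show "strict_mono_on {fg_s \<alpha>..fg_P \<alpha> m} (free_gamma_density \<alpha>)"
    proof (rule strict_mono_onI)
      fix \<xi> \<zeta> assume x: "\<xi> \<in> {fg_s \<alpha>..fg_P \<alpha> m}" "\<zeta> \<in> {fg_s \<alpha>..fg_P \<alpha> m}" "\<xi> < \<zeta>"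
      have "inv (fg_P \<alpha>) \<xi> \<in> {- fg_c \<alpha>..m}" "inv (fg_P \<alpha>) \<zeta> \<in> {- fg_c \<alpha>..m}"
        using x mono[of "fg_s \<alpha>"] mono[of _ "fg_P \<alpha> m"] by (auto simp: s inv_fg_P_fg_P)
      from strict_mono_onD[OF m(2) this inv_fg_P_strict_mono[OF x(3)]]
      show "free_gamma_density \<alpha> \<xi> < free_gamma_density \<alpha> \<zeta>"
        by (simp add: free_gamma_density_eq divide_strict_right_mono)
    qed
    show "strict_antimono_on {fg_P \<alpha> m..} (free_gamma_density \<alpha>)"
    proof (rule monotone_onI)
      fix \<xi> \<zeta> assume x: "\<xi> \<in> {fg_P \<alpha> m..}" "\<zeta> \<in> {fg_P \<alpha> m..}" "\<xi> < \<zeta>"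
      have "inv (fg_P \<alpha>) \<xi> \<in> {m..}" "inv (fg_P \<alpha>) \<zeta> \<in> {m..}"
        using x mono[of "fg_P \<alpha> m"] by (auto simp: inv_fg_P_fg_P)
      from monotone_onD[OF m(3) this inv_fg_P_strict_mono[OF x(3)]]
      show "free_gamma_density \<alpha> \<xi> > free_gamma_density \<alpha> \<zeta>"
        by (simp add: free_gamma_density_eq divide_strict_right_mono)
    qed
  qed
qed

lemma unimodal_free_gamma_density: "unimodal (free_gamma_density \<alpha>)"
proof -
  obtain \<omega> where \<omega>: "\<omega> > fg_s \<alpha>" "strict_mono_on {fg_s \<alpha>..\<omega>} (free_gamma_density \<alpha>)"
      "strict_antimono_on {\<omega>..} (free_gamma_density \<alpha>)"
    using free_gamma_density_strictly_unimodal by (elim exE conjE) (rule that)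
  have nonneg: "free_gamma_density \<alpha> \<xi> \<ge> 0" for \<xi>
    using fg_v_nonneg[OF \<alpha>] by (auto simp add: free_gamma_density_eq fg_Q_def)
  show ?thesis
    unfolding unimodal_def
  proof (intro exI[of _ \<omega>] conjI)
    show "mono_on {..<\<omega>} (free_gamma_density \<alpha>)"
    proof (rule mono_onI)
      fix x y assume xy: "x \<in> {..<\<omega>}" "y \<in> {..<\<omega>}" "x \<le> y"
      show "free_gamma_density \<alpha> x \<le> free_gamma_density \<alpha> y"
      proof (cases "x \<le> fg_s \<alpha>")
        case True
        then show ?thesis using nonneg[of y] by (simp add: free_gamma_density_def)
      next
        case False
        then show ?thesis using xy strict_mono_onD[OF \<omega>(2), of x y] by (cases "x = y") auto
      qed
    qed
    show "antimono_on {\<omega><..} (free_gamma_density \<alpha>)"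
    proof (rule monotone_onI)
      fix x y assume xy: "x \<in> {\<omega><..}" "y \<in> {\<omega><..}" "x \<le> y"
      then show "free_gamma_density \<alpha> x \<ge> free_gamma_density \<alpha> y"
        using monotone_onD[OF \<omega>(3), of x y] by (cases "x = y") auto
    qed
  qed
qed

end

section \<open>The Levy-Khintchine triplet of the Gamma distribution\<close>

lemma has_vector_derivative_iff_quotient:
  fixes f :: "real \<Rightarrow> 'c::real_normed_vector"
  shows "(f has_vector_derivative D) (at x) \<longleftrightarrow> ((\<lambda>y. (f y - f x) /\<^sub>R (y - x)) \<longlongrightarrow> D) (at x)"
proof -
  have eq: "norm (f y - f x - (y - x) *\<^sub>R D) / norm (y - x) = norm ((f y - f x) /\<^sub>R (y - x) - D)" if "y \<noteq> x" for y
  proof -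
    have "(f y - f x) /\<^sub>R (y - x) - D = (f y - f x - (y - x) *\<^sub>R D) /\<^sub>R (y - x)"
      using that by (simp add: scaleR_diff_right)
    then show ?thesis by (simp add: divide_inverse)
  qed
  have "(f has_vector_derivative D) (at x) \<longleftrightarrow>
      ((\<lambda>y. norm (f y - f x - (y - x) *\<^sub>R D) / norm (y - x)) \<longlongrightarrow> 0) (at x)"
    unfolding has_vector_derivative_def has_derivative_iff_norm by (simp add: bounded_linear_scaleR_left)
  also have "\<dots> \<longleftrightarrow> ((\<lambda>y. norm ((f y - f x) /\<^sub>R (y - x) - D)) \<longlongrightarrow> 0) (at x)"
    by (intro filterlim_cong refl, unfold eventually_at_filter, intro always_eventually allI impI eq)
  also have "\<dots> \<longleftrightarrow> ((\<lambda>y. (f y - f x) /\<^sub>R (y - x)) \<longlongrightarrow> D) (at x)"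
    by (simp add: tendsto_norm_zero_iff LIM_zero_iff)
  finally show ?thesis .
qed

text \<open>Differentiation under the integral sign.  By the mean value inequality, a bound on the derivative
  of the integrand also dominates its difference quotients.\<close>

lemma has_vector_derivative_lebesgue_integral:
  fixes g :: "real \<Rightarrow> 'a \<Rightarrow> 'c::{banach, second_countable_topology}"
  assumes int: "\<And>u. integrable M (g u)"
    and der: "\<And>u t. t \<in> space M \<Longrightarrow> ((\<lambda>u. g u t) has_vector_derivative g' u t) (at u)"
    and meas [measurable]: "g' u \<in> borel_measurable M"
    and w: "integrable M w" and bound: "\<And>u t. t \<in> space M \<Longrightarrow> norm (g' u t) \<le> w t"
  shows "((\<lambda>u. LINT t|M. g u t) has_vector_derivative (LINT t|M. g' u t)) (at u)"
  unfolding has_vector_derivative_iff_quotient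
proof -
  have [measurable]: "g v \<in> borel_measurable M" for v using int by auto
  have lip: "norm (g v t - g u t) \<le> w t * norm (v - u)" if "t \<in> space M" for v t
  proof (rule differentiable_bound[where S = UNIV and f' = "\<lambda>u x. x *\<^sub>R g' u t"])
    show "((\<lambda>u. g u t) has_derivative (\<lambda>x. x *\<^sub>R g' u t)) (at u within UNIV)" for u
      using der[OF that, of u] by (simp add: has_vector_derivative_def)
    show "onorm (\<lambda>x. x *\<^sub>R g' u t) \<le> w t" for u
      using bound[OF that, of u] by (intro onorm_le) (simp add: mult.commute mult_left_mono)
  qed auto
  have "((\<lambda>v. LINT t|M. (g v t - g u t) /\<^sub>R (v - u)) \<longlongrightarrow> (LINT t|M. g' u t)) (at u)"
  proof (rule integral_dominated_convergence_within[OF _ _ w])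
    show "AE t in M. ((\<lambda>v. (g v t - g u t) /\<^sub>R (v - u)) \<longlongrightarrow> g' u t) (at u)"
      using der by (auto simp: has_vector_derivative_iff_quotient)
    have "norm ((g v t - g u t) /\<^sub>R (v - u)) \<le> w t" if "t \<in> space M" "v \<noteq> u" for v t
      using lip[OF that(1), of v] that(2) by (simp add: divide_simps mult.commute)
    then show "\<forall>\<^sub>F v in at u. AE t in M. norm ((g v t - g u t) /\<^sub>R (v - u)) \<le> w t"
      by (auto simp: eventually_at_filter)
  qed simp_all
  then show "((\<lambda>v. ((LINT t|M. g v t) - (LINT t|M. g u t)) /\<^sub>R (v - u)) \<longlongrightarrow> (LINT t|M. g' u t)) (at u)"
    using int by simp
qed

lemma Gamma_plus1_pos: "a > 0 \<Longrightarrow> Gamma (a + 1) = a * Gamma (a::real)"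
  by (rule Gamma_plus1) (auto elim!: nonpos_Ints_cases)

text \<open>Multiplication by \<open>t\<close>, and hence differentiation of the characteristic function, raises the
  parameter by one.\<close>

lemma gamma_density_Suc:
  assumes "a > 0"
  shows "t * gamma_density a t = a * gamma_density (a + 1) t"
proof -
  have "t * t powr (a - 1) = t powr a" if "t \<ge> 0"
    using that powr_mult_base[of t "a - 1"] by simp
  then show ?thesis
    using assms Gamma_real_pos[OF assms]
    by (simp add: gamma_density_def indicator_def Gamma_plus1_pos mult.assoc[symmetric])
qed

text \<open>At \<open>t = 0\<close> the formula \<open>t powr 0\<close> gives \<open>0\<close>, which is why the indicator is that of the open
  half-line.\<close>

lemma gamma_density_1: "gamma_density 1 t = indicator {0<..} t * exp (- t)"
  by (auto simp: gamma_density_def indicator_def)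

lemma integrable_gamma_density: "a > 0 \<Longrightarrow> integrable lborel (gamma_density a)"
  using prob_space.finite_measure[OF prob_space_gamma_distribution] integrable_gamma_distribution[of a "\<lambda>_. 1::real"]
  by (simp add: finite_measure.integrable_const)

lemma integral_gamma_density: "a > 0 \<Longrightarrow> (LINT t|lborel. gamma_density a t) = 1"
  using integral_gamma_distribution[of a "\<lambda>_. 1::real"] prob_space.prob_space[OF prob_space_gamma_distribution, of a]
  by simp

lemma integrable_gamma_density_mult:
  fixes f :: "real \<Rightarrow> complex"
  assumes "a > 0" and [measurable]: "f \<in> borel_measurable borel" and "\<And>t. cmod (f t) \<le> B"
  shows "integrable lborel (\<lambda>t. gamma_density a t *\<^sub>R f t)"
proof (rule Bochner_Integration.integrable_bound)
  show "integrable lborel (\<lambda>t. B * gamma_density a t)" using integrable_gamma_density[OF assms(1)] by simp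
  have "gamma_density a t * cmod (f t) \<le> gamma_density a t * B" for t
    using assms gamma_density_nonneg[OF assms(1), of t] by (intro mult_left_mono) auto
  moreover have "B \<ge> 0" using assms(3)[of 0] norm_ge_zero order_trans by blast
  ultimately show "AE t in lborel. norm (gamma_density a t *\<^sub>R f t) \<le> norm (B * gamma_density a t)"
    using gamma_density_nonneg[OF assms(1)] by (auto simp: abs_mult mult.commute)
qed simp

lemma char_gamma_eq: "a > 0 \<Longrightarrow> char (gamma_distribution a) u = (LINT t|lborel. gamma_density a t *\<^sub>R iexp (u * t))"
  unfolding char_def by (intro integral_gamma_distribution) auto

lemma integral_derivative_half_line:
  fixes F f :: "real \<Rightarrow> complex"
  assumes "\<And>t. t > 0 \<Longrightarrow> (F has_vector_derivative f t) (at t)" "\<And>t. t > 0 \<Longrightarrow> isCont f t"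
    and "integrable lborel (\<lambda>t. indicator {0<..} t *\<^sub>R f t)"
    and "(F \<longlongrightarrow> A) (at_right 0)" "(F \<longlongrightarrow> B) at_top"
  shows "(LINT t|lborel. indicator {0<..} t *\<^sub>R f t) = B - A"
proof -
  have "(LBINT t=ereal 0..\<infinity>. f t) = B - A"
  proof (rule interval_integral_FTC_integrable[where F = F])
    show "set_integrable lborel (einterval (ereal 0) \<infinity>) f"
      using assms(3) by (simp add: set_integrable_def)
    show "((F \<circ> real_of_ereal) \<longlongrightarrow> A) (at_right (ereal 0))"
      using assms(4) by (simp only: ereal_tendsto_simps)
    show "((F \<circ> real_of_ereal) \<longlongrightarrow> B) (at_left \<infinity>)"
      using assms(5) by (simp only: ereal_tendsto_simps)
  qed (use assms in auto)
  then show ?thesis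
    by (simp add: interval_lebesgue_integral_def set_lebesgue_integral_def)
qed

lemma one_minus_i_mult_nonzero: "1 - \<i> * complex_of_real u \<noteq> 0"
  by (simp add: complex_eq_iff)

lemma char_gamma_1: "(1 - \<i> * of_real u) * char (gamma_distribution 1) u = 1"
proof -
  define s where "s = 1 - \<i> * complex_of_real u"
  have eq: "gamma_density 1 t *\<^sub>R iexp (u * t) = indicator {0<..} t *\<^sub>R exp (- s * of_real t)" for t
    by (auto simp: gamma_density_1 indicator_def s_def exp_of_real[symmetric] exp_add[symmetric] algebra_simps
        scaleR_conv_of_real)
  have "(LINT t|lborel. indicator {0<..} t *\<^sub>R (s * exp (- s * of_real t))) = 0 - (- 1)"
  proof (rule integral_derivative_half_line[where F = "\<lambda>t. - exp (- s * of_real t)"])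
    show "((\<lambda>t. - exp (- s * of_real t)) has_vector_derivative s * exp (- s * of_real t)) (at t)" for t :: real
      by (auto intro!: derivative_eq_intros has_vector_derivative_real_field simp: algebra_simps)
    have "((\<lambda>t. - exp (- s * complex_of_real t)) \<longlongrightarrow> - exp (- s * of_real 0)) (at_right 0)"
      by (intro tendsto_intros)
    then show "((\<lambda>t. - exp (- s * complex_of_real t)) \<longlongrightarrow> - 1) (at_right 0)" by simp
    have "((\<lambda>t::real. exp (- t)) \<longlongrightarrow> 0) at_top" by real_asymp
    then have "((\<lambda>t. cmod (- exp (- s * complex_of_real t))) \<longlongrightarrow> 0) at_top"
      by (simp add: s_def)
    then show "((\<lambda>t. - exp (- s * complex_of_real t)) \<longlongrightarrow> 0) at_top"
      by (rule tendsto_norm_zero_cancel)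
    have "integrable lborel (\<lambda>t. s * (gamma_density 1 t *\<^sub>R iexp (u * t)))"
      by (intro integrable_mult_right integrable_gamma_density_mult[where B = 1]) auto
    then show "integrable lborel (\<lambda>t. indicator {0<..} t *\<^sub>R (s * exp (- s * of_real t)))"
      unfolding eq by simp
  qed (auto intro!: continuous_intros)
  then have "s * (LINT t|lborel. indicator {0<..} t *\<^sub>R exp (- s * complex_of_real t)) = 1"
    by (simp only: mult_scaleR_right[symmetric] integral_mult_right_zero) simp
  then show ?thesis
    unfolding s_def[symmetric] char_gamma_eq[OF zero_less_one] eq .
qed

text \<open>Integration by parts: \<open>t powr a * exp (- (1 - i u) t)\<close> vanishes at both ends of the half-line.\<close>

lemma char_gamma_Suc:
  assumes "a > 0"
  shows "(1 - \<i> * of_real u) * char (gamma_distribution (a + 1)) u = char (gamma_distribution a) u"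
proof -
  define s where "s = 1 - \<i> * complex_of_real u"
  define F where "F t = (t powr a / Gamma (a + 1)) *\<^sub>R exp (- s * of_real t)" for t :: real
  define f where "f t = (t powr (a - 1) / Gamma a) *\<^sub>R exp (- s * of_real t) - s * ((t powr a / Gamma (a + 1)) *\<^sub>R exp (- s * of_real t))" for t :: real
  have G: "Gamma a > 0" "Gamma (a + 1) > 0" "Gamma (a + 1) = a * Gamma a"
    using assms by (auto simp: Gamma_real_pos Gamma_plus1_pos)
  have e: "exp (- s * of_real t) = exp (- t) *\<^sub>R iexp (u * t)" for t :: real
    by (auto simp: s_def exp_of_real[symmetric] exp_add[symmetric] algebra_simps scaleR_conv_of_real)
  have eq: "indicator {0<..} t *\<^sub>R f t = gamma_density a t *\<^sub>R iexp (u * t) - s * (gamma_density (a + 1) t *\<^sub>R iexp (u * t))" for t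
    unfolding f_def e by (auto simp: gamma_density_def indicator_def scaleR_conv_of_real mult.assoc)
  have ia: "integrable lborel (\<lambda>t. gamma_density a t *\<^sub>R iexp (u * t))"
    "integrable lborel (\<lambda>t. s * (gamma_density (a + 1) t *\<^sub>R iexp (u * t)))"
    by (intro integrable_mult_right integrable_gamma_density_mult[where B = 1]; use assms in simp)+
  have nF: "cmod (F t) = t powr a * exp (- t) / Gamma (a + 1)" for t
    using G(2) unfolding F_def e by (simp add: norm_mult)
  have "(LINT t|lborel. indicator {0<..} t *\<^sub>R f t) = 0 - 0"
  proof (rule integral_derivative_half_line[where F = F])
    show "(F has_vector_derivative f t) (at t)" if "t > 0" for t :: real
    proof -
      have "((\<lambda>t. t powr a / Gamma (a + 1)) has_real_derivative (a * t powr (a - 1)) / Gamma (a + 1)) (at t)"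
        using that by (intro DERIV_cdivide has_real_derivative_powr)
      moreover have "(a * t powr (a - 1)) / Gamma (a + 1) = t powr (a - 1) / Gamma a"
        using assms G by simp
      moreover have "((\<lambda>t. exp (- s * of_real t)) has_vector_derivative - s * exp (- s * of_real t)) (at t)"
        by (auto intro!: derivative_eq_intros has_vector_derivative_real_field simp: algebra_simps)
      ultimately have "(F has_vector_derivative (t powr a / Gamma (a + 1)) *\<^sub>R (- s * exp (- s * of_real t)) +
          (t powr (a - 1) / Gamma a) *\<^sub>R exp (- s * of_real t)) (at t)"
        unfolding F_def[abs_def] by (intro has_vector_derivative_scaleR) simp_all
      then show ?thesis by (simp add: f_def add.commute)
    qed
    show "isCont f t" if "t > 0" for t :: real
      unfolding f_def[abs_def] using that G(1,2) by (intro continuous_intros) auto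
    show "integrable lborel (\<lambda>t. indicator {0<..} t *\<^sub>R f t)" unfolding eq using ia by auto
    have "((\<lambda>t. t powr a * exp (- t)) \<longlongrightarrow> 0) (at_right 0)" using assms by real_asymp
    then have "((\<lambda>t. t powr a * exp (- t) / Gamma (a + 1)) \<longlongrightarrow> 0) (at_right 0)" by (rule tendsto_divide_zero)
    then show "(F \<longlongrightarrow> 0) (at_right 0)" by (intro tendsto_norm_zero_cancel[of F]) (simp add: nF)
    have "((\<lambda>t. t powr a * exp (- t)) \<longlongrightarrow> 0) at_top" using assms by real_asymp
    then have "((\<lambda>t. t powr a * exp (- t) / Gamma (a + 1)) \<longlongrightarrow> 0) at_top" by (rule tendsto_divide_zero)
    then show "(F \<longlongrightarrow> 0) at_top" by (intro tendsto_norm_zero_cancel[of F]) (simp add: nF)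
  qed
  then have "(LINT t|lborel. gamma_density a t *\<^sub>R iexp (u * t)) = s * (LINT t|lborel. gamma_density (a + 1) t *\<^sub>R iexp (u * t))"
    unfolding eq Bochner_Integration.integral_diff[OF ia] integral_mult_right_zero by simp
  then show ?thesis using assms by (simp add: char_gamma_eq s_def)
qed

lemma has_vector_derivative_iexp: "((\<lambda>u. iexp (u * t)) has_vector_derivative \<i> * of_real t * iexp (u * t)) (at u)"
  by (auto intro!: derivative_eq_intros has_vector_derivative_real_field simp: algebra_simps)

lemma has_vector_derivative_char_gamma:
  assumes "a > 0"
  shows "(char (gamma_distribution a) has_vector_derivative
    \<i> * of_real a * char (gamma_distribution (a + 1)) u) (at u)"
proof -
  have "((\<lambda>u. LINT t|lborel. gamma_density a t *\<^sub>R iexp (u * t)) has_vector_derivative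
      (LINT t|lborel. gamma_density a t *\<^sub>R (\<i> * of_real t * iexp (u * t)))) (at u)"
  proof (rule has_vector_derivative_lebesgue_integral[where w = "\<lambda>t. a * gamma_density (a + 1) t"])
    show "integrable lborel (\<lambda>t. gamma_density a t *\<^sub>R iexp (u * t))" for u
      using assms by (intro integrable_gamma_density_mult[where B = 1]) auto
    show "((\<lambda>u. gamma_density a t *\<^sub>R iexp (u * t)) has_vector_derivative
        gamma_density a t *\<^sub>R (\<i> * of_real t * iexp (u * t))) (at u)" for u t
      by (intro bounded_linear.has_vector_derivative[OF bounded_linear_scaleR_right] has_vector_derivative_iexp)
    have "t * gamma_density a t \<ge> 0" for t
      using assms by (simp add: gamma_density_Suc gamma_density_nonneg)
    then have "norm (gamma_density a t *\<^sub>R (\<i> * of_real t * iexp (u * t))) = t * gamma_density a t" for u t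
      by (metis (no_types, lifting) abs_mult abs_of_nonneg mult.commute mult.right_neutral mult_1 norm_exp_i_times norm_ii norm_mult norm_of_real norm_scaleR)
    then show "norm (gamma_density a t *\<^sub>R (\<i> * of_real t * iexp (u * t))) \<le> a * gamma_density (a + 1) t" for u t
      by (simp add: gamma_density_Suc[OF assms])
  qed (use assms integrable_gamma_density in auto)
  also have "(\<lambda>t. gamma_density a t *\<^sub>R (\<i> * of_real t * iexp (u * t))) =
      (\<lambda>t. \<i> * of_real a * (gamma_density (a + 1) t *\<^sub>R iexp (u * t)))"
  proof
    fix t
    have "complex_of_real (t * gamma_density a t) = of_real (a * gamma_density (a + 1) t)"
      using gamma_density_Suc[OF assms] by simp
    then show "gamma_density a t *\<^sub>R (\<i> * of_real t * iexp (u * t)) = \<i> * of_real a * (gamma_density (a + 1) t *\<^sub>R iexp (u * t))"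
      by (simp add: scaleR_conv_of_real mult_ac)
  qed
  finally have "((\<lambda>u. LINT t|lborel. gamma_density a t *\<^sub>R iexp (u * t)) has_vector_derivative
      \<i> * of_real a * (LINT t|lborel. gamma_density (a + 1) t *\<^sub>R iexp (u * t))) (at u)"
    by (simp only: integral_mult_right_zero)
  moreover have "char (gamma_distribution a) = (\<lambda>u. LINT t|lborel. gamma_density a t *\<^sub>R iexp (u * t))"
    using char_gamma_eq[OF assms] by (rule ext)
  ultimately show ?thesis
    using char_gamma_eq[of "a + 1" u] assms by simp
qed

definition gamma_levy_measure :: "real \<Rightarrow> real measure" where
  "gamma_levy_measure \<alpha> = density lborel (\<lambda>t. ennreal (\<alpha> * gamma_density 1 t / t))"

lemma gamma_levy_density_nonneg: "\<alpha> > 0 \<Longrightarrow> \<alpha> * gamma_density 1 t / t \<ge> 0"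
  by (simp add: gamma_density_1 indicator_def)

lemma integral_gamma_levy:
  fixes f :: "real \<Rightarrow> complex"
  assumes "\<alpha> > 0" and [measurable]: "f \<in> borel_measurable borel"
  shows "(LINT t|gamma_levy_measure \<alpha>. f t) = (LINT t|lborel. (\<alpha> * gamma_density 1 t / t) *\<^sub>R f t)"
  unfolding gamma_levy_measure_def using gamma_levy_density_nonneg[OF assms(1)]
  by (subst integral_density) auto

lemma integral_gamma_density_1_truncated:
  "(LINT t|lborel. gamma_density 1 t * indicator {-1..1} t) = 1 - exp (- 1)"
proof -
  have "(LINT t|lborel. gamma_density 1 t * indicator {-1..1} t) = (LINT t|lborel. exp (- t) * indicator {0..1::real} t)"
  proof (rule integral_cong_AE)
    show "AE t in lborel. gamma_density 1 t * indicator {-1..1} t = exp (- t) * indicator {0..1} t"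
      using AE_lborel_singleton[of 0] by eventually_elim (auto simp: gamma_density_1 indicator_def)
  qed auto
  also have "\<dots> = - exp (- 1) - (- exp (- 0))"
    by (rule integral_FTC_Icc_real) (auto intro!: derivative_eq_intros continuous_intros)
  finally show ?thesis by simp
qed

text \<open>As the Levy measure integrates \<open>t\<close> near the origin, the exponent converges without the
  compensating term; the drift \<open>\<alpha> (1 - 1/e)\<close> in the triplet cancels that term.\<close>

definition gamma_exponent :: "real \<Rightarrow> real \<Rightarrow> complex" where
  "gamma_exponent \<alpha> u = (LINT t|lborel. (\<alpha> * gamma_density 1 t / t) *\<^sub>R (iexp (u * t) - 1))"

context
  fixes \<alpha> :: real
  assumes \<alpha>: "\<alpha> > 0"
begin

lemma levy_measure_gamma: "levy_measure (gamma_levy_measure \<alpha>)"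
  unfolding levy_measure_def
proof (intro conjI)
  have [measurable]: "(\<lambda>t. ennreal (\<alpha> * gamma_density 1 t / t)) \<in> borel_measurable borel" by measurable
  show "sets (gamma_levy_measure \<alpha>) = sets borel" by (simp add: gamma_levy_measure_def)
  have "emeasure (gamma_levy_measure \<alpha>) {0} = (\<integral>\<^sup>+t. ennreal (\<alpha> * gamma_density 1 t / t) * indicator {0} t \<partial>lborel)"
    by (simp add: gamma_levy_measure_def emeasure_density)
  also have "\<dots> = (\<integral>\<^sup>+t. 0 \<partial>(lborel :: real measure))" by (intro nn_integral_cong) (auto simp: indicator_def)
  finally show "emeasure (gamma_levy_measure \<alpha>) {0} = 0" by simp
  have "(\<integral>\<^sup>+t. ennreal (min 1 (t\<^sup>2)) \<partial>gamma_levy_measure \<alpha>) =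
      (\<integral>\<^sup>+t. ennreal (\<alpha> * gamma_density 1 t / t) * ennreal (min 1 (t\<^sup>2)) \<partial>lborel)"
    unfolding gamma_levy_measure_def by (subst nn_integral_density) auto
  also have "\<dots> \<le> (\<integral>\<^sup>+t. ennreal (\<alpha> * gamma_density 1 t) \<partial>lborel)"
  proof (intro nn_integral_mono)
    fix t :: real
    have "(\<alpha> * gamma_density 1 t / t) * min 1 (t\<^sup>2) \<le> \<alpha> * gamma_density 1 t"
    proof (cases "t > 0")
      case True
      have "min 1 (t\<^sup>2) \<le> t"
        using True mult_left_le[of t t] by (auto simp: power2_eq_square min_le_iff_disj)
      then have "(\<alpha> * gamma_density 1 t / t) * min 1 (t\<^sup>2) \<le> (\<alpha> * gamma_density 1 t / t) * t"
        using gamma_levy_density_nonneg[OF \<alpha>] by (intro mult_left_mono) auto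
      then show ?thesis using True by simp
    qed (simp add: gamma_density_1)
    then show "ennreal (\<alpha> * gamma_density 1 t / t) * ennreal (min 1 (t\<^sup>2)) \<le> ennreal (\<alpha> * gamma_density 1 t)"
      using gamma_levy_density_nonneg[OF \<alpha>, of t] by (simp add: ennreal_mult[symmetric] ennreal_leI)
  qed
  also have "\<dots> = ennreal (LINT t|lborel. \<alpha> * gamma_density 1 t)"
    using \<alpha> by (intro nn_integral_eq_integral) (auto simp: gamma_density_nonneg integrable_gamma_density)
  also have "\<dots> < \<infinity>" by simp
  finally show "(\<integral>\<^sup>+t. ennreal (min 1 (t\<^sup>2)) \<partial>gamma_levy_measure \<alpha>) < \<infinity>" .
qed

lemma integrable_gamma_exponent: "integrable lborel (\<lambda>t. (\<alpha> * gamma_density 1 t / t) *\<^sub>R (iexp (u * t) - 1))"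
proof (rule Bochner_Integration.integrable_bound)
  show "integrable lborel (\<lambda>t. \<bar>u\<bar> * (\<alpha> * gamma_density 1 t))"
    using integrable_gamma_density[of 1] by simp
  have "norm ((\<alpha> * gamma_density 1 t / t) *\<^sub>R (iexp (u * t) - 1)) \<le> norm (\<bar>u\<bar> * (\<alpha> * gamma_density 1 t))" for t
  proof (cases "t > 0")
    case True
    have "cmod (iexp (u * t) - 1) \<le> \<bar>u\<bar> * t"
      using iexp_approx1[of "u * t" 0] True by (simp add: abs_mult)
    then have "(\<alpha> * gamma_density 1 t / t) * cmod (iexp (u * t) - 1) \<le> (\<alpha> * gamma_density 1 t / t) * (\<bar>u\<bar> * t)"
      using gamma_levy_density_nonneg[OF \<alpha>] by (intro mult_left_mono) auto
    then show ?thesis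
      using True gamma_levy_density_nonneg[OF \<alpha>, of t] gamma_density_nonneg[of 1 t] \<alpha> by (simp add: abs_mult mult_ac)
  qed (simp add: gamma_density_1)
  then show "AE t in lborel. norm ((\<alpha> * gamma_density 1 t / t) *\<^sub>R (iexp (u * t) - 1)) \<le> norm (\<bar>u\<bar> * (\<alpha> * gamma_density 1 t))"
    by simp
qed simp

lemma has_vector_derivative_gamma_exponent:
  "(gamma_exponent \<alpha> has_vector_derivative \<i> * of_real \<alpha> * char (gamma_distribution 1) u) (at u)"
proof -
  have eq: "(\<alpha> * gamma_density 1 t / t) *\<^sub>R (\<i> * of_real t * iexp (u * t)) = \<i> * of_real \<alpha> * (gamma_density 1 t *\<^sub>R iexp (u * t))" for u t
    by (cases "t = 0") (simp_all add: gamma_density_1 scaleR_conv_of_real)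
  have "((\<lambda>u. LINT t|lborel. (\<alpha> * gamma_density 1 t / t) *\<^sub>R (iexp (u * t) - 1)) has_vector_derivative
      (LINT t|lborel. (\<alpha> * gamma_density 1 t / t) *\<^sub>R (\<i> * of_real t * iexp (u * t)))) (at u)"
  proof (rule has_vector_derivative_lebesgue_integral[where w = "\<lambda>t. \<alpha> * gamma_density 1 t"])
    show "integrable lborel (\<lambda>t. (\<alpha> * gamma_density 1 t / t) *\<^sub>R (iexp (u * t) - 1))" for u
      by (rule integrable_gamma_exponent)
    have "((\<lambda>u. iexp (u * t) - 1) has_vector_derivative \<i> * of_real t * iexp (u * t) - 0) (at u)" for u t
      by (intro has_vector_derivative_diff has_vector_derivative_iexp has_vector_derivative_const)
    then show "((\<lambda>u. (\<alpha> * gamma_density 1 t / t) *\<^sub>R (iexp (u * t) - 1)) has_vector_derivative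
        (\<alpha> * gamma_density 1 t / t) *\<^sub>R (\<i> * of_real t * iexp (u * t))) (at u)" for u t
      by (intro bounded_linear.has_vector_derivative[OF bounded_linear_scaleR_right]) simp
    show "norm ((\<alpha> * gamma_density 1 t / t) *\<^sub>R (\<i> * of_real t * iexp (u * t))) \<le> \<alpha> * gamma_density 1 t" for u t
      unfolding eq using \<alpha> gamma_density_nonneg[of 1 t] by (simp add: norm_mult)
  qed (use integrable_gamma_density in auto)
  then show ?thesis
    unfolding eq integral_mult_right_zero gamma_exponent_def[abs_def] char_gamma_eq[OF zero_less_one] .
qed

text \<open>Both sides solve \<open>\<phi>' = (i \<alpha> / (1 - i u)) \<phi>\<close> with \<open>\<phi> 0 = 1\<close>; the factor \<open>1 / (1 - i u)\<close> is the
  characteristic function of the exponential distribution.\<close>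

lemma char_gamma_eq_exp: "char (gamma_distribution \<alpha>) u = exp (gamma_exponent \<alpha> u)"
proof -
  let ?\<phi> = "char (gamma_distribution \<alpha>)"
  have ode: "\<i> * of_real \<alpha> * char (gamma_distribution (\<alpha> + 1)) u = \<i> * of_real \<alpha> * char (gamma_distribution 1) u * ?\<phi> u" for u
  proof -
    have "(1 - \<i> * of_real u) * char (gamma_distribution (\<alpha> + 1)) u =
        (1 - \<i> * of_real u) * (char (gamma_distribution 1) u * ?\<phi> u)"
      using char_gamma_Suc[OF \<alpha>, of u] char_gamma_1[of u] by (simp add: mult.assoc[symmetric])
    then have "char (gamma_distribution (\<alpha> + 1)) u = char (gamma_distribution 1) u * ?\<phi> u"
      by (rule mult_left_cancel[OF one_minus_i_mult_nonzero, THEN iffD1])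
    then show ?thesis by simp
  qed
  have "((\<lambda>u. ?\<phi> u * exp (- gamma_exponent \<alpha> u)) has_vector_derivative
      ?\<phi> u * ((- (\<i> * of_real \<alpha> * char (gamma_distribution 1) u)) * exp (- gamma_exponent \<alpha> u)) +
      \<i> * of_real \<alpha> * char (gamma_distribution (\<alpha> + 1)) u * exp (- gamma_exponent \<alpha> u)) (at u)" for u
  proof (rule has_vector_derivative_mult[OF has_vector_derivative_char_gamma[OF \<alpha>]])
    have "((\<lambda>u. - gamma_exponent \<alpha> u) has_vector_derivative - (\<i> * of_real \<alpha> * char (gamma_distribution 1) u)) (at u)"
      by (intro has_vector_derivative_minus has_vector_derivative_gamma_exponent)
    from field_vector_diff_chain_at[OF this DERIV_exp]
    show "((\<lambda>u. exp (- gamma_exponent \<alpha> u)) has_vector_derivative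
        - (\<i> * of_real \<alpha> * char (gamma_distribution 1) u) * exp (- gamma_exponent \<alpha> u)) (at u)"
      by (simp add: o_def mult.commute)
  qed
  then have "((\<lambda>u. ?\<phi> u * exp (- gamma_exponent \<alpha> u)) has_vector_derivative 0) (at u)" for u
    unfolding ode by (simp add: mult_ac)
  then obtain c where c: "\<And>u. ?\<phi> u * exp (- gamma_exponent \<alpha> u) = c"
    using has_vector_derivative_zero_constant[of UNIV "\<lambda>u. ?\<phi> u * exp (- gamma_exponent \<alpha> u)"] by auto
  interpret real_distribution "gamma_distribution \<alpha>"
    using prob_space_gamma_distribution[OF \<alpha>] by (simp add: real_distribution_def real_distribution_axioms_def)
  have "gamma_exponent \<alpha> 0 = 0" by (simp add: gamma_exponent_def)
  then have "c = 1" using c[of 0] char_zero by simp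
  then show ?thesis using c[of u] by (simp add: exp_minus field_simps)
qed

lemma gamma_levy_khintchine_triplet:
  "levy_khintchine_triplet (gamma_distribution \<alpha>) 0 (gamma_levy_measure \<alpha>) (\<alpha> * (1 - exp (- 1)))"
proof -
  have "(LINT t|gamma_levy_measure \<alpha>. iexp (u * t) - 1 - \<i> * of_real (u * t * indicator {-1..1} t)) =
      gamma_exponent \<alpha> u - \<i> * of_real (\<alpha> * (1 - exp (- 1)) * u)" for u
  proof -
    let ?h = "\<lambda>t. (\<alpha> * gamma_density 1 t / t) *\<^sub>R (iexp (u * t) - 1)"
    let ?k = "\<lambda>t. (gamma_density 1 t * indicator {-1..1} t) *\<^sub>R (\<i> * complex_of_real (\<alpha> * u))"
    have ik: "integrable lborel (\<lambda>t. gamma_density 1 t * indicator {-1..1} t)"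
      using integrable_mult_indicator[OF _ integrable_gamma_density[of 1], of "{-1..1}"] by (simp add: mult.commute)
    have "(LINT t|gamma_levy_measure \<alpha>. iexp (u * t) - 1 - \<i> * of_real (u * t * indicator {-1..1} t)) =
        (LINT t|lborel. (\<alpha> * gamma_density 1 t / t) *\<^sub>R (iexp (u * t) - 1 - \<i> * of_real (u * t * indicator {-1..1} t)))"
      by (rule integral_gamma_levy[OF \<alpha>]) measurable
    also have "\<dots> = (LINT t|lborel. ?h t - ?k t)"
    proof (intro Bochner_Integration.integral_cong refl)
      fix t :: real
      show "(\<alpha> * gamma_density 1 t / t) *\<^sub>R (iexp (u * t) - 1 - \<i> * of_real (u * t * indicator {-1..1} t)) = ?h t - ?k t"
        by (cases "t > 0") (simp_all add: gamma_density_1 scaleR_conv_of_real field_simps)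
    qed
    also have "\<dots> = gamma_exponent \<alpha> u - (LINT t|lborel. ?k t)"
      unfolding gamma_exponent_def using integrable_gamma_exponent ik by (intro Bochner_Integration.integral_diff) auto
    also have "(LINT t|lborel. ?k t) = (1 - exp (- 1)) *\<^sub>R (\<i> * complex_of_real (\<alpha> * u))"
      using ik by (simp add: integral_gamma_density_1_truncated)
    finally show ?thesis by (simp add: scaleR_conv_of_real mult_ac)
  qed
  then show ?thesis
    unfolding levy_khintchine_triplet_def
    using levy_measure_gamma prob_space_gamma_distribution[OF \<alpha>]
    by (auto simp: real_distribution_def real_distribution_axioms_def char_gamma_eq_exp)
qed

end

section \<open>Stieltjes inversion and the density of the free Gamma distribution\<close>

lemma (in real_distribution) cauchy_energy_pos:
  assumes "Im z \<noteq> 0"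
  shows "cauchy_energy M z > 0"
proof -
  have "(LINT t|M. 0) < (LINT t|M. 1 / (cmod (z - complex_of_real t))\<^sup>2)"
  proof (rule integral_less_AE_space)
    show "integrable M (\<lambda>t. 1 / (cmod (z - complex_of_real t))\<^sup>2)"
      by (intro integrable_energy away_from_nonreal assms)
    have "z \<noteq> complex_of_real t" for t using assms by auto
    then show "AE t in M. 0 < 1 / (cmod (z - complex_of_real t))\<^sup>2" by simp
  qed (use emeasure_space_1 in auto)
  then show ?thesis by (simp add: cauchy_energy_def)
qed

text \<open>The Cauchy transform of a probability measure maps the upper half-plane to the lower one.\<close>

lemma (in real_distribution) reciprocal_cauchy_transform_upper:
  assumes "Im u > 0"
  shows "cauchy_transform M u \<noteq> 0" "Im (1 / cauchy_transform M u) > 0"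
proof -
  have "Im (cauchy_transform M u) < 0"
    using Im_cauchy_transform[OF away_from_nonreal, of u] cauchy_energy_pos[of u] assms by simp
  then show "cauchy_transform M u \<noteq> 0" by auto
  then have "(cmod (cauchy_transform M u))\<^sup>2 > 0" by simp
  then show "Im (1 / cauchy_transform M u) > 0"
    using \<open>Im (cauchy_transform M u) < 0\<close> by (simp add: Im_divide cmod_power2 divide_neg_pos)
qed

lemma (in real_distribution) holomorphic_cauchy_transform:
  "cauchy_transform M holomorphic_on {u. Im u > 0}"
  unfolding holomorphic_on_def field_differentiable_def
proof
  fix u assume "u \<in> {u. Im u > 0}"
  then have "Im u \<noteq> 0" by auto
  from has_field_derivative_cauchy_transform[OF away_from_nonreal[OF this]]
  show "\<exists>D. (cauchy_transform M has_field_derivative D) (at u within {u. Im u > 0})"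
    by (meson has_field_derivative_at_within)
qed

text \<open>On the line at height \<open>e\<close>, \<open>- Im G / \<pi>\<close> is the derivative of the integral of
  \<open>arctan ((x - t) / e) / \<pi>\<close>.  As \<open>e\<close> tends to \<open>0\<close> this antiderivative converges to the integral of
  \<open>sgn (x - t) / 2\<close>, whose increments are masses of intervals, up to atoms at the end points.
  The bound on \<open>G\<close> allows passage to the limit in the integral of the derivative and excludes
  atoms.\<close>

lemma (in real_distribution) stieltjes_inversion:
  fixes f :: "real \<Rightarrow> real"
  assumes bound: "\<And>z. Im z > 0 \<Longrightarrow> cmod (cauchy_transform M z) \<le> B"
    and lim: "\<And>x. (\<lambda>n. - Im (cauchy_transform M (Complex x (1 / real (Suc n)))) / pi) \<longlonglongrightarrow> f x"
  shows "M = density lborel (\<lambda>x. ennreal (f x))"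
proof -
  define e where "e n = 1 / real (Suc n)" for n
  have e: "e n > 0" for n by (simp add: e_def)
  have e0: "e \<longlonglongrightarrow> 0" unfolding e_def by (rule LIMSEQ_Suc[OF lim_1_over_n])
  define g where "g n x = - Im (cauchy_transform M (Complex x (e n))) / pi" for n x
  have away: "away_from M (Complex x (e n))" for x n using e[of n] by (intro away_from_nonreal) simp
  have contg: "isCont (g n) x" for n x
  proof -
    have "isCont (\<lambda>x. cauchy_transform M (Complex x (e n))) x"
      unfolding Complex_eq
      by (rule isCont_o2[where f = "\<lambda>x. of_real x + \<i> * of_real (e n)"])
         (use away[of x n] in \<open>auto intro!: continuous_intros DERIV_isCont has_field_derivative_cauchy_transform simp: Complex_eq\<close>)
    then show ?thesis unfolding g_def by (intro continuous_intros) auto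
  qed
  then have [measurable]: "g n \<in> borel_measurable borel" for n
    by (intro borel_measurable_continuous_onI continuous_at_imp_continuous_on) auto
  have gf: "(\<lambda>n. g n x) \<longlonglongrightarrow> f x" for x using lim by (simp add: g_def e_def)
  then have [measurable]: "f \<in> borel_measurable borel" by (rule borel_measurable_LIMSEQ_real) measurable
  have g_eq: "g n x = e n / pi * cauchy_energy M (Complex x (e n))" for n x
    unfolding g_def Im_cauchy_transform[OF away] by simp
  have gnn: "g n x \<ge> 0" for n x
    using e[of n] unfolding g_eq cauchy_energy_def by (intro mult_nonneg_nonneg integral_nonneg) auto
  have gB: "g n x \<le> B / pi" for n x
  proof -
    have "- Im (cauchy_transform M (Complex x (e n))) \<le> B"
      using bound[of "Complex x (e n)"] e[of n] abs_Im_le_cmod[of "cauchy_transform M (Complex x (e n))"] by auto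
    then show ?thesis unfolding g_def by (rule divide_right_mono) simp
  qed
  have fnn: "f x \<ge> 0" for x using gf[of x] gnn by (intro LIMSEQ_le_const) auto
  have fB: "f x \<le> B / pi" for x using gf[of x] gB by (intro LIMSEQ_le_const2) auto
  have "0 \<le> B / pi" using order_trans[OF fnn[of 0] fB[of 0]] .
  then have B: "B \<ge> 0" unfolding pos_le_divide_eq[OF pi_gt_zero] by simp
  define A where "A n x = (LINT t|M. arctan ((x - t) / e n) / pi)" for n x
  define S where "S x = (LINT t|M. sgn (x - t) / 2)" for x
  have intS: "integrable M (\<lambda>t. sgn (x - t) / 2)" for x
    by (rule integrable_const_bound[where B = "1/2"]) (auto simp: sgn_if)
  have intA: "integrable M (\<lambda>t. arctan ((x - t) / e n) / pi)" for x n
  proof (rule integrable_const_bound[where B = "1/2"])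
    have "\<bar>arctan y\<bar> \<le> pi / 2" for y using arctan_bounded[of y] by auto
    then show "AE t in M. norm (arctan ((x - t) / e n) / pi) \<le> 1 / 2" by (simp add: divide_simps)
  qed simp
  have derA: "(A n has_real_derivative g n x) (at x)" for n x
  proof -
    have "((\<lambda>x. LINT t|M. arctan ((x - t) / e n) / pi) has_vector_derivative
        (LINT t|M. e n / pi * (1 / (cmod (Complex x (e n) - complex_of_real t))\<^sup>2))) (at x)"
    proof (rule has_vector_derivative_lebesgue_integral[where w = "\<lambda>t. 1 / (pi * e n)"])
      show "((\<lambda>x. arctan ((x - t) / e n) / pi) has_vector_derivative
          e n / pi * (1 / (cmod (Complex x (e n) - complex_of_real t))\<^sup>2)) (at x)" for x t
      proof -
        have "(e n)\<^sup>2 + (x - t)\<^sup>2 > 0" using e[of n] by (intro add_pos_nonneg) auto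
        then have "1 / e n / (1 + ((x - t) / e n)\<^sup>2) / pi = e n / pi * (1 / ((x - t)\<^sup>2 + (e n)\<^sup>2))"
          using e[of n] by (simp add: power_divide divide_simps) (simp add: power2_eq_square algebra_simps)
        moreover have "((\<lambda>x. arctan ((x - t) / e n) / pi) has_real_derivative 1 / e n / (1 + ((x - t) / e n)\<^sup>2) / pi) (at x)"
          using e[of n] by (auto intro!: derivative_eq_intros simp: divide_simps)
        ultimately show ?thesis
          by (simp add: has_real_derivative_iff_has_vector_derivative cmod_power2)
      qed
      have "e n / pi * (1 / (cmod (Complex x (e n) - complex_of_real t))\<^sup>2) \<le> e n / pi * (1 / (e n)\<^sup>2)" for x t
        using e[of n] by (intro mult_left_mono divide_left_mono) (auto simp: cmod_power2 intro!: mult_pos_pos add_nonneg_pos)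
      also have "e n / pi * (1 / (e n)\<^sup>2) = 1 / (pi * e n)"
        using e[of n] by (simp add: power2_eq_square)
      finally have "e n / pi * (1 / (cmod (Complex x (e n) - complex_of_real t))\<^sup>2) \<le> 1 / (pi * e n)" for x t .
      then show "norm (e n / pi * (1 / (cmod (Complex x (e n) - complex_of_real t))\<^sup>2)) \<le> 1 / (pi * e n)" for x t
        using e[of n] by simp
    qed (use intA in auto)
    moreover have "(LINT t|M. e n / pi * (1 / (cmod (Complex x (e n) - complex_of_real t))\<^sup>2)) = g n x"
      unfolding g_eq cauchy_energy_def by (rule integral_mult_right_zero)
    ultimately show ?thesis
      by (simp add: A_def[abs_def] has_real_derivative_iff_has_vector_derivative)
  qed
  have limA: "(\<lambda>n. A n x) \<longlonglongrightarrow> S x" for x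
    unfolding A_def S_def
  proof (rule integral_dominated_convergence[where w = "\<lambda>_. 1/2"])
    have "\<bar>arctan y\<bar> \<le> pi / 2" for y using arctan_bounded[of y] by auto
    then show "AE t in M. norm (arctan ((x - t) / e n) / pi) \<le> 1 / 2" for n by (simp add: divide_simps)
    have "(\<lambda>n. arctan ((x - t) / e n) / pi) \<longlonglongrightarrow> sgn (x - t) / 2" for t
    proof -
      have inv: "filterlim (\<lambda>n. inverse (e n)) at_top sequentially"
        using e e0 by (intro filterlim_inverse_at_top) auto
      have eq: "(x - t) / e n = (x - t) * inverse (e n)" for n by (rule divide_inverse)
      consider "x = t" | "x > t" | "x < t" by linarith
      then show ?thesis
      proof cases
        case 2
        then have "filterlim (\<lambda>n. (x - t) * inverse (e n)) at_top sequentially"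
          using inv by (intro filterlim_tendsto_pos_mult_at_top[OF tendsto_const]) auto
        then have "(\<lambda>n. arctan ((x - t) * inverse (e n)) / pi) \<longlonglongrightarrow> (pi / 2) / pi"
          by (intro tendsto_intros filterlim_compose[OF tendsto_arctan_at_top]) auto
        moreover have "sgn (x - t) / 2 = (pi / 2) / pi" using 2 by simp
        ultimately show ?thesis by (simp only: eq)
      next
        case 3
        then have "filterlim (\<lambda>n. (x - t) * inverse (e n)) at_bot sequentially"
          using inv by (intro filterlim_tendsto_neg_mult_at_bot[OF tendsto_const]) auto
        then have "(\<lambda>n. arctan ((x - t) * inverse (e n)) / pi) \<longlonglongrightarrow> (- (pi / 2)) / pi"
          by (intro tendsto_intros filterlim_compose[OF tendsto_arctan_at_bot]) auto
        moreover have "sgn (x - t) / 2 = (- (pi / 2)) / pi" using 3 by simp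
        ultimately show ?thesis by (simp only: eq)
      qed simp
    qed
    then show "AE t in M. (\<lambda>n. arctan ((x - t) / e n) / pi) \<longlonglongrightarrow> sgn (x - t) / 2" by simp
  qed (auto)
  have iB: "integrable lborel (\<lambda>x. B / pi * indicator {a..b} x :: real)" for a b :: real
    by (intro integrable_mult_right integrable_real_indicator) (auto simp: emeasure_lborel_Icc_eq)
  have intf: "integrable lborel (\<lambda>x. f x * indicator {a..b} x)" for a b
  proof (rule Bochner_Integration.integrable_bound)
    show "integrable lborel (\<lambda>x. B / pi * indicator {a..b} x :: real)" by (rule iB)
    show "AE x in lborel. norm (f x * indicator {a..b} x) \<le> norm (B / pi * indicator {a..b} x)"
      using fnn fB B by (auto simp: indicator_def)
  qed simp
  have SS: "S b - S a = (LINT x|lborel. f x * indicator {a..b} x)" if "a \<le> b" for a b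
  proof -
    have "(\<lambda>n. LINT x|lborel. g n x * indicator {a..b} x) \<longlonglongrightarrow> (LINT x|lborel. f x * indicator {a..b} x)"
    proof (rule integral_dominated_convergence[where w = "\<lambda>x. B / pi * indicator {a..b} x"])
      show "AE x in lborel. (\<lambda>n. g n x * indicator {a..b} x) \<longlonglongrightarrow> f x * indicator {a..b} x"
        using gf by (auto intro!: tendsto_intros)
      show "AE x in lborel. norm (g n x * indicator {a..b} x) \<le> B / pi * indicator {a..b} x" for n
        using gnn gB by (auto simp: indicator_def)
    qed (use iB in auto)
    moreover have "(LINT x|lborel. g n x * indicator {a..b} x) = A n b - A n a" for n
      using that derA contg by (intro integral_FTC_Icc_real) auto
    moreover have "(\<lambda>n. A n b - A n a) \<longlonglongrightarrow> S b - S a" by (intro tendsto_intros limA)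
    ultimately show ?thesis using LIMSEQ_unique by simp
  qed
  \<comment> \<open>An atom at \<open>x\<close> would make \<open>S\<close> jump there, but \<open>S\<close> is Lipschitz by \<open>SS\<close>.\<close>
  have null: "measure M {x} = 0" for x
  proof -
    have "measure M {x} \<le> B / pi * (2 * h)" if "h > 0" for h
    proof -
      have "measure M {x} = (LINT t|M. indicator {x} t)" by simp
      also have "\<dots> \<le> (LINT t|M. sgn (x + h - t) / 2 - sgn (x - h - t) / 2)"
      proof (rule integral_mono)
        show "integrable M (indicator {x} :: real \<Rightarrow> real)"
          by (rule integrable_const_bound[where B = 1]) auto
        show "integrable M (\<lambda>t. sgn (x + h - t) / 2 - sgn (x - h - t) / 2)" using intS by simp
      qed (use that in \<open>auto simp: sgn_if indicator_def\<close>)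
      also have "\<dots> = S (x + h) - S (x - h)" unfolding S_def using intS by simp
      also have "\<dots> = (LINT y|lborel. f y * indicator {x - h..x + h} y)" using that by (intro SS) simp
      also have "\<dots> \<le> (LINT y|lborel. B / pi * indicator {x - h..x + h} y)"
        using fB by (intro integral_mono intf iB) (auto simp: indicator_def)
      also have "\<dots> = B / pi * (2 * h)" unfolding integral_mult_right_zero using that by simp
      finally show ?thesis .
    qed
    moreover have "((\<lambda>h. B / pi * (2 * h)) \<longlongrightarrow> B / pi * (2 * 0)) (at_right 0)" by (intro tendsto_intros)
    ultimately have "measure M {x} \<le> B / pi * (2 * 0)"
      by (intro tendsto_lowerbound[where F = "at_right 0"]) (auto simp: eventually_at_filter)
    then show ?thesis by (simp add: measure_le_0_iff)
  qed
  have Icc: "emeasure M {a..b} = emeasure (density lborel (\<lambda>x. ennreal (f x))) {a..b}" if "a < b" for a b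
  proof -
    have AEn: "AE t in M. t \<noteq> x" for x
      by (rule AE_I[of _ _ "{x}"]) (auto simp: emeasure_eq_measure null)
    have "measure M {a..b} = (LINT t|M. indicator {a..b} t)" by simp
    also have "\<dots> = (LINT t|M. sgn (b - t) / 2 - sgn (a - t) / 2)"
    proof (rule integral_cong_AE)
      show "AE t in M. indicator {a..b} t = sgn (b - t) / 2 - sgn (a - t) / 2"
        using AEn[of a] AEn[of b] by eventually_elim (use that in \<open>auto simp: sgn_if indicator_def\<close>)
    qed simp_all
    also have "\<dots> = S b - S a" unfolding S_def using intS by simp
    also have "\<dots> = (LINT x|lborel. f x * indicator {a..b} x)" using that by (intro SS) simp
    finally have "emeasure M {a..b} = ennreal (LINT x|lborel. f x * indicator {a..b} x)"
      by (simp add: emeasure_eq_measure)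
    also have "\<dots> = (\<integral>\<^sup>+x. ennreal (f x * indicator {a..b} x) \<partial>lborel)"
      using intf fnn by (intro nn_integral_eq_integral[symmetric]) auto
    also have "\<dots> = emeasure (density lborel (\<lambda>x. ennreal (f x))) {a..b}"
      by (subst emeasure_density) (auto intro!: nn_integral_cong simp: indicator_def)
    finally show ?thesis .
  qed
  show ?thesis
  proof (rule measure_eqI_lessThan)
    fix x
    show "emeasure M {x<..} < \<infinity>" using emeasure_finite by (simp add: top.not_eq_extremum[symmetric])
    \<comment> \<open>Compact intervals that exhaust the half-line; they are nondegenerate only for \<open>n > 0\<close>.\<close>
    define C where "C n = {x + e n..x + 1 + real n}" for n
    have "incseq C"
      unfolding incseq_def C_def e_def by (auto simp: frac_le intro: order_trans[rotated])
    have U: "(\<Union>n. C n) = {x<..}"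
    proof (intro equalityI subsetI)
      fix y assume "y \<in> (\<Union>n. C n)"
      then obtain n where "x + e n \<le> y" by (auto simp: C_def)
      then show "y \<in> {x<..}" using e[of n] by auto
    next
      fix y assume y: "y \<in> {x<..}"
      have "\<forall>\<^sub>F n in sequentially. e n < y - x" using order_tendstoD(2)[OF e0, of "y - x"] y by simp
      moreover have "\<forall>\<^sub>F n in sequentially. y \<le> x + 1 + real n" by real_asymp
      ultimately have "\<forall>\<^sub>F n in sequentially. y \<in> C n"
        by eventually_elim (auto simp: C_def)
      then show "y \<in> (\<Union>n. C n)" using eventually_happens' by force
    qed
    have "(\<lambda>n. emeasure M (C n)) \<longlonglongrightarrow> emeasure M {x<..}"
      unfolding U[symmetric] by (intro Lim_emeasure_incseq \<open>incseq C\<close>) (auto simp: C_def)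
    moreover have "(\<lambda>n. emeasure (density lborel (\<lambda>x. ennreal (f x))) (C n)) \<longlonglongrightarrow>
        emeasure (density lborel (\<lambda>x. ennreal (f x))) {x<..}"
      unfolding U[symmetric] by (intro Lim_emeasure_incseq \<open>incseq C\<close>) (auto simp: C_def)
    moreover have "\<forall>\<^sub>F n in sequentially. emeasure M (C n) = emeasure (density lborel (\<lambda>x. ennreal (f x))) (C n)"
      using eventually_gt_at_top[of 0]
    proof eventually_elim
      case (elim n)
      have "e n \<le> 1" by (simp add: e_def)
      with elim show ?case unfolding C_def by (intro Icc) auto
    qed
    ultimately show "emeasure M {x<..} = emeasure (density lborel (\<lambda>x. ennreal (f x))) {x<..}"
      using LIMSEQ_unique tendsto_cong by metis
  qed auto
qed

context
  fixes \<alpha> :: real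
  assumes \<alpha>: "\<alpha> > 0"
begin

text \<open>The integrand equals \<open>\<alpha> z e\<^sup>-\<^sup>t / (1 - t z)\<close> up to the compensating term, and \<open>1 / (1 - t z)\<close>
  is \<open>1 + t / (w - t)\<close> with \<open>w = 1 / z\<close>: the first summand gives the constant \<open>\<alpha>\<close> of \<open>H w\<close>, the second
  one the Cauchy transform.\<close>

lemma free_levy_khintchine_gamma:
  assumes "Im z \<noteq> 0"
  shows "1 + free_levy_khintchine 0 (gamma_levy_measure \<alpha>) (\<alpha> * (1 - exp (- 1))) z = z * fg_H \<alpha> (1 / z)"
proof -
  let ?K = "cauchy_transform (gamma_distribution 2) (1 / z)"
  have z: "z \<noteq> 0" using assms by auto
  have "Im (1 / z) \<noteq> 0" using assms by (simp add: Im_divide sum_power2_eq_zero_iff)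
  then have aw: "away_from (gamma_distribution 2) (1 / z)" by (rule away_from_nonreal)
  have ne: "1 - complex_of_real t * z \<noteq> 0" for t
  proof
    assume "1 - complex_of_real t * z = 0"
    then have "Im (1 - complex_of_real t * z) = 0" "Re (1 - complex_of_real t * z) = 0" by simp_all
    then show False using assms by auto
  qed
  let ?k = "\<lambda>t. (gamma_density 1 t * indicator {-1..1} t) *\<^sub>R (of_real \<alpha> * z)"
  let ?l = "\<lambda>t. gamma_density 1 t *\<^sub>R (of_real \<alpha> * z)"
  let ?m = "\<lambda>t. of_real \<alpha> * z * (gamma_density 2 t *\<^sub>R (1 / (1 / z - complex_of_real t)))"
  have ik: "integrable lborel (\<lambda>t. gamma_density 1 t * indicator {-1..1} t)"
    using integrable_mult_indicator[OF _ integrable_gamma_density[of 1], of "{-1..1}"] by (simp add: mult.commute)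
  have il: "integrable lborel (gamma_density 1)" by (rule integrable_gamma_density) simp
  have im: "integrable lborel (\<lambda>t. gamma_density 2 t *\<^sub>R (1 / (1 / z - complex_of_real t)))"
    using gamma2.integrable_resolvent[OF aw] by (subst (asm) integrable_gamma_distribution) auto
  have "(LINT t|gamma_levy_measure \<alpha>. 1 / (1 - of_real t * z) - 1 - of_real (t * indicator {-1..1} t) * z) =
      (LINT t|lborel. (\<alpha> * gamma_density 1 t / t) *\<^sub>R (1 / (1 - of_real t * z) - 1 - of_real (t * indicator {-1..1} t) * z))"
    by (rule integral_gamma_levy[OF \<alpha>]) measurable
  also have "\<dots> = (LINT t|lborel. (?l t + ?m t) - ?k t)"
  proof (intro integral_cong_AE)
    show "AE t in lborel. (\<alpha> * gamma_density 1 t / t) *\<^sub>R (1 / (1 - of_real t * z) - 1 - of_real (t * indicator {-1..1} t) * z) =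
        (?l t + ?m t) - ?k t"
      using AE_lborel_singleton[of 0]
    proof eventually_elim
      case (elim t)
      show ?case
      proof (cases "t > 0")
        case True
        have g2: "gamma_density 2 t = t * gamma_density 1 t" using True by (simp add: gamma_density_1 gamma_density_2)
        have r: "1 / (1 / z - complex_of_real t) = z / (1 - of_real t * z)"
          using z ne[of t] by (simp add: divide_simps)
        have q: "1 / (1 - of_real t * z) - 1 = of_real t * z / (1 - of_real t * z)"
          using ne[of t] by (simp add: divide_simps)
        have s: "1 + of_real t * z / (1 - of_real t * z) = 1 / (1 - of_real t * z)"
          using ne[of t] by (simp add: divide_simps)
        have "(\<alpha> * gamma_density 1 t / t) *\<^sub>R (1 / (1 - of_real t * z) - 1) =
            of_real (\<alpha> * gamma_density 1 t) * (z * (1 / (1 - of_real t * z)))"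
          unfolding q using True by (simp add: scaleR_conv_of_real)
        also have "\<dots> = ?l t + ?m t"
          unfolding s[symmetric] r g2 by (simp add: scaleR_conv_of_real algebra_simps)
        finally have "(\<alpha> * gamma_density 1 t / t) *\<^sub>R (1 / (1 - of_real t * z) - 1) = ?l t + ?m t" .
        moreover have "(\<alpha> * gamma_density 1 t / t) *\<^sub>R (of_real (t * indicator {-1..1} t) * z) = ?k t"
          using True by (simp add: scaleR_conv_of_real)
        ultimately show ?thesis by (simp only: scaleR_diff_right)
      qed (use elim in \<open>simp add: gamma_density_1 gamma_density_2\<close>)
    qed
  qed measurable
  also have "\<dots> = (LINT t|lborel. ?l t) + (LINT t|lborel. ?m t) - (LINT t|lborel. ?k t)"
  proof -
    have "integrable lborel ?k" "integrable lborel ?l" using ik il by auto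
    moreover have "integrable lborel ?m" using im by (rule integrable_mult_right)
    ultimately show ?thesis
      by (simp only: Bochner_Integration.integral_diff Bochner_Integration.integral_add Bochner_Integration.integrable_add)
  qed
  also have "(LINT t|lborel. ?l t) = of_real \<alpha> * z"
    using il by (simp add: integral_gamma_density)
  also have "(LINT t|lborel. ?m t) = of_real \<alpha> * z * ?K"
    by (simp only: integral_mult_right_zero) (simp add: cauchy_transform_def integral_gamma_distribution)
  also have "(LINT t|lborel. ?k t) = of_real (\<alpha> * (1 - exp (- 1))) * z"
    unfolding integral_scaleR_left[OF ik] integral_gamma_density_1_truncated
    by (simp add: scaleR_conv_of_real mult_ac)
  finally have "1 + free_levy_khintchine 0 (gamma_levy_measure \<alpha>) (\<alpha> * (1 - exp (- 1))) z =
      1 + of_real \<alpha> * z + of_real \<alpha> * z * ?K"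
    by (simp add: free_levy_khintchine_def)
  also have "\<dots> = z * fg_H \<alpha> (1 / z)" using z by (simp add: fg_H_eq algebra_simps)
  finally show ?thesis .
qed

text \<open>On the cone, this is the equation for the free cumulant transform at \<open>G u\<close>; both sides are
  holomorphic in the upper half-plane.\<close>

lemma fg_H_reciprocal_cauchy_transform:
  assumes "free_gamma_distribution \<alpha> \<nu>" "Im u > 0"
  shows "fg_H \<alpha> (1 / cauchy_transform \<nu> u) = u"
proof -
  let ?C = "free_levy_khintchine 0 (gamma_levy_measure \<alpha>) (\<alpha> * (1 - exp (- 1)))" and ?G = "cauchy_transform \<nu>"
  have "real_distribution \<nu>" "has_free_cumulant_transform \<nu> ?C"
    using assms(1) gamma_levy_khintchine_triplet[OF \<alpha>]
    unfolding free_gamma_distribution_def bercovici_pata_def by blast+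
  then obtain \<theta> M where \<theta>: "\<theta> > 0" "M > 0" "inj_on ?G (truncated_cone \<theta> M)"
    and C: "\<And>z. z \<in> ?G ` truncated_cone \<theta> M \<Longrightarrow> free_cumulant_transform (truncated_cone \<theta> M) \<nu> z = ?C z"
    unfolding has_free_cumulant_transform_def by blast
  interpret real_distribution \<nu> by fact
  define D where "D = truncated_cone \<theta> M"
  have sub: "D \<subseteq> {u. Im u > 0}" using \<theta>(2) by (auto simp: D_def truncated_cone_def)
  have cone: "fg_H \<alpha> (1 / ?G u) = u" if "u \<in> D" for u
  proof -
    have u: "Im u > 0" using that sub by auto
    have "Im (?G u) \<noteq> 0"
      using Im_cauchy_transform[OF away_from_nonreal, of u] cauchy_energy_pos[of u] u by simp
    have "the_inv_into D ?G (?G u) = u"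
      using \<theta>(3) that by (simp add: D_def the_inv_into_f_f)
    then have "?G u * u - 1 = ?C (?G u)"
      using C[of "?G u"] that by (simp add: D_def free_cumulant_transform_def)
    then have "?G u * u = ?G u * fg_H \<alpha> (1 / ?G u)"
      using free_levy_khintchine_gamma[OF \<open>Im (?G u) \<noteq> 0\<close>] by (simp add: algebra_simps)
    then show ?thesis using reciprocal_cauchy_transform_upper(1)[OF u] by simp
  qed
  have "open D"
    unfolding D_def truncated_cone_def by (intro open_Collect_conj open_Collect_less continuous_intros)
  moreover have "D \<noteq> {}"
  proof -
    have "Complex 0 (M + 1) \<in> D" using \<theta> by (auto simp: D_def truncated_cone_def)
    then show ?thesis by blast
  qed
  moreover have "(\<lambda>u. fg_H \<alpha> (1 / ?G u)) holomorphic_on {u. Im u > 0}"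
  proof (rule holomorphic_on_compose_gen[OF _ holomorphic_on_fg_H[OF \<alpha>], unfolded o_def])
    show "(\<lambda>u. 1 / ?G u) holomorphic_on {u. Im u > 0}"
      using reciprocal_cauchy_transform_upper(1) by (intro holomorphic_intros holomorphic_cauchy_transform) auto
    show "(\<lambda>u. 1 / ?G u) ` {u. Im u > 0} \<subseteq> - \<real>\<^sub>\<ge>\<^sub>0"
      using reciprocal_cauchy_transform_upper(2) by (force simp: complex_nonneg_Reals_iff)
  qed
  moreover have "connected {u. Im u > 0}" by (intro convex_connected convex_halfspace_Im_gt)
  moreover have "open {u. Im u > 0}" by (rule open_halfspace_Im_gt)
  ultimately show ?thesis
    using analytic_continuation_open[of D "{u. Im u > 0}" "\<lambda>u. fg_H \<alpha> (1 / ?G u)" "\<lambda>u. u" u] sub cone assms(2)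
    by auto
qed

text \<open>For \<open>w\<close> in the upper half-plane, \<open>Im (H w) = Im w (1 - \<alpha> F w)\<close> is positive only if
  \<open>F w < 1 / \<alpha>\<close>.\<close>

lemma reciprocal_cauchy_transform_in_region:
  assumes "free_gamma_distribution \<alpha> \<nu>" "real_distribution \<nu>" "Im u > 0"
  shows "1 / cauchy_transform \<nu> u \<in> fg_region \<alpha>"
proof -
  let ?w = "1 / cauchy_transform \<nu> u"
  have w: "Im ?w > 0" using real_distribution.reciprocal_cauchy_transform_upper(2)[OF assms(2,3)] .
  then have slit: "?w \<notin> \<real>\<^sub>\<ge>\<^sub>0" by (auto simp: complex_nonneg_Reals_iff)
  have "0 < Im (fg_H \<alpha> ?w)" using fg_H_reciprocal_cauchy_transform[OF assms(1,3)] assms(3) by simp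
  then have "0 < 1 - \<alpha> * fg_F ?w" unfolding Im_fg_H[OF \<alpha> slit] using w by (simp only: zero_less_mult_iff) auto
  then have "fg_F ?w \<le> 1 / \<alpha>" using \<alpha> by (simp add: field_simps)
  with w slit show ?thesis unfolding fg_region_def by auto
qed

text \<open>\<open>H\<close> maps these reciprocals to points that converge to \<open>\<xi>\<close>, so it suffices that \<open>H\<close> has a continuous
  inverse.  It has one on a compact part of the region, on which it is continuous and
  injective.\<close>

lemma reciprocal_cauchy_transform_boundary_limit:
  fixes \<xi> :: real
  assumes "free_gamma_distribution \<alpha> \<nu>" "real_distribution \<nu>"
  defines "x \<equiv> inv (fg_P \<alpha>) \<xi>"
  shows "(\<lambda>n. 1 / cauchy_transform \<nu> (Complex \<xi> (1 / real (Suc n)))) \<longlonglongrightarrow> Complex x (fg_v \<alpha> x)"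
proof -
  let ?H = "fg_H \<alpha>"
  define u where "u n = Complex \<xi> (1 / real (Suc n))" for n
  define w where "w n = 1 / cauchy_transform \<nu> (u n)" for n
  define w0 where "w0 = Complex x (fg_v \<alpha> x)"
  \<comment> \<open>All points involved are mapped by \<open>H\<close> into the disc of radius \<open>\<bar>\<xi>\<bar> + 1\<close>, and \<open>H\<close> moves points by
    at most the remaining summands.\<close>
  define R where "R = \<bar>\<xi>\<bar> + 1 + \<alpha> + (\<alpha> + 1) / 2"
  define K where "K = fg_region \<alpha> \<inter> cball 0 R"
  have Im: "Im (u n) > 0" for n by (simp add: u_def)
  have Hw: "?H (w n) = u n" and wr: "w n \<in> fg_region \<alpha>" for n
    using fg_H_reciprocal_cauchy_transform[OF assms(1) Im] reciprocal_cauchy_transform_in_region[OF assms(1,2) Im]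
    by (simp_all add: w_def)
  have Hw0: "?H w0 = of_real \<xi>"
    using fg_H_curve[OF \<alpha>, of x] bij_fg_P[OF \<alpha>] by (simp add: w0_def x_def bij_is_surj surj_f_inv_f)
  have w0r: "w0 \<in> fg_region \<alpha>" unfolding w0_def by (rule fg_curve_in_region[OF \<alpha>])
  have inK: "z \<in> K" if "z \<in> fg_region \<alpha>" "cmod (?H z) \<le> \<bar>\<xi>\<bar> + 1" for z
  proof -
    have "cmod z \<le> cmod (?H z) + cmod (?H z - z)"
      using norm_triangle_ineq4[of "?H z" "?H z - z"] by simp
    then show ?thesis using norm_fg_H_minus_id_le[OF \<alpha> that(1)] that by (simp add: K_def R_def)
  qed
  have "cmod (u n) \<le> \<bar>\<xi>\<bar> + 1" for n
    using cmod_le[of "u n"] by (simp add: u_def) (smt (verit) divide_le_eq_1 of_nat_0_le_iff)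
  then have wK: "w n \<in> K" for n using inK[OF wr] by (simp add: Hw)
  have w0K: "w0 \<in> K" using inK[OF w0r] by (simp add: Hw0)
  have "compact K" unfolding K_def using closed_fg_region[OF \<alpha>] by (intro closed_Int_compact) auto
  moreover have "continuous_on K ?H"
    using isCont_fg_H[OF \<alpha>] by (intro continuous_at_imp_continuous_on) (auto simp: K_def fg_region_def)
  moreover have inj: "inj_on ?H K"
    using inj_on_fg_H_region[OF \<alpha>] by (rule inj_on_subset) (auto simp: K_def)
  ultimately have cont: "continuous_on (?H ` K) (the_inv_into K ?H)"
    by (intro continuous_on_inv) (auto simp: the_inv_into_f_f)
  have "(\<lambda>n. Complex \<xi> (1 / real (Suc n))) \<longlonglongrightarrow> Complex \<xi> 0"
    by (intro tendsto_Complex tendsto_const LIMSEQ_Suc[OF lim_1_over_n])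
  then have "(\<lambda>n. ?H (w n)) \<longlonglongrightarrow> ?H w0" by (simp add: Hw Hw0 u_def complex_of_real_def)
  then have "(\<lambda>n. the_inv_into K ?H (?H (w n))) \<longlonglongrightarrow> the_inv_into K ?H (?H w0)"
    using wK w0K by (intro continuous_on_tendsto_compose[OF cont]) auto
  then have "w \<longlonglongrightarrow> w0" using wK w0K inj by (simp add: the_inv_into_f_f)
  then show ?thesis by (simp add: w_def[abs_def] w0_def u_def)
qed

text \<open>As the closed region avoids the origin, \<open>1 / G\<close> is bounded away from \<open>0\<close>, which gives both the
  bound needed for the inversion and the boundary limit of \<open>G\<close> itself.\<close>

lemma free_gamma_distribution_density:
  assumes "free_gamma_distribution \<alpha> \<nu>"
  shows "\<nu> = density lborel (\<lambda>\<xi>. ennreal (free_gamma_density \<alpha> \<xi>))"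
proof -
  have rd: "real_distribution \<nu>"
    using assms gamma_levy_khintchine_triplet[OF \<alpha>]
    unfolding free_gamma_distribution_def bercovici_pata_def by blast
  have "0 \<notin> fg_region \<alpha>" by (simp add: fg_region_def)
  with closed_fg_region[OF \<alpha>] obtain \<delta> where \<delta>: "\<delta> > 0" "\<And>w. w \<in> fg_region \<alpha> \<Longrightarrow> \<delta> \<le> cmod w"
    using separate_point_closed[of "fg_region \<alpha>" 0] by (auto simp: dist_norm)
  show ?thesis
  proof (rule real_distribution.stieltjes_inversion[OF rd])
    fix z assume z: "Im z > 0"
    have "\<delta> \<le> cmod (1 / cauchy_transform \<nu> z)"
      by (intro \<delta>(2) reciprocal_cauchy_transform_in_region assms rd z)
    then show "cmod (cauchy_transform \<nu> z) \<le> 1 / \<delta>"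
      using real_distribution.reciprocal_cauchy_transform_upper(1)[OF rd z] \<delta>(1)
      by (simp add: norm_divide field_simps)
  next
    fix \<xi>
    let ?x = "inv (fg_P \<alpha>) \<xi>"
    let ?w0 = "Complex ?x (fg_v \<alpha> ?x)" and ?G = "\<lambda>n. cauchy_transform \<nu> (Complex \<xi> (1 / real (Suc n)))"
    have "?w0 \<noteq> 0" using \<delta>(2)[OF fg_curve_in_region[OF \<alpha>, of ?x]] \<delta>(1) by auto
    then have "(\<lambda>n. - Im (1 / (1 / ?G n)) / pi) \<longlonglongrightarrow> - Im (1 / ?w0) / pi"
      by (intro tendsto_intros reciprocal_cauchy_transform_boundary_limit assms rd) auto
    moreover have "- Im (1 / ?w0) / pi = free_gamma_density \<alpha> \<xi>"
      by (simp add: free_gamma_density_eq[OF \<alpha>] fg_Q_def Im_divide)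
    ultimately show "(\<lambda>n. - Im (?G n) / pi) \<longlonglongrightarrow> free_gamma_density \<alpha> \<xi>"
      by simp
  qed
qed

end

theorem theorem5p3:
  fixes \<alpha> :: real
  assumes "\<alpha> > 0"
  shows "(\<forall>\<nu>. free_gamma_distribution \<alpha> \<nu> \<longrightarrow>
            \<nu> = density lborel (\<lambda>\<xi>. ennreal (free_gamma_density \<alpha> \<xi>))) \<and>
         unimodal (free_gamma_density \<alpha>) \<and>
         (\<exists>\<omega>. \<omega> > fg_s \<alpha> \<and>
            strict_mono_on {fg_s \<alpha>..\<omega>} (free_gamma_density \<alpha>) \<and>
            strict_antimono_on {\<omega>..} (free_gamma_density \<alpha>))"
  using free_gamma_distribution_density[OF assms] unimodal_free_gamma_density[OF assms]
    free_gamma_density_strictly_unimodal[OF assms]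
  by auto

end
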